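(* There exist two disjoint Wiener regular domains $\Omega_1,\Omega_2\subset\mathbb{R}^2$ with $1$-rectifiable boundaries, and points $p_1\in\Omega_1$, $p_2\in\Omega_2$, such that the set $E:=\partial\Omega_1\cap\partial\Omega_2$ satisfies: (a) $\mathcal{H}^1(E)>0$; (b) $\omega_1^{p_1}(E)=\omega_2^{p_2}(E)=0$, where $\omega_i^{p_i}$ is the harmonic measure for $\Omega_i$ with pole at $p_i$; (c) the Alt-Caffarelli-Friedman functional $J(x,r)$ associated with the Green functions $g_1(\cdot,p_1)$ of $\Omega_1$ and $g_2(\cdot,p_2)$ of $\Omega_2$ satisfies $J(x,0^+):=\lim_{r\to0^+}J(x,r)=0$ for $\mathcal{H}^1$-a.e. $x\in E$.
   Context: A domain is Wiener regular if the Dirichlet problem for the Laplacian with continuous boundary data is solvable in it. A set $F\subset\mathbb{R}^2$ is $1$-rectifiable if there are Lipschitz maps $f_i:\mathbb{R}\to\mathbb{R}^2$, $i\in\mathbb{N}$, with $\mathcal{H}^1(F\setminus\bigcup_i f_i(\mathbb{R}))=0$. The functions $u_i=g_i(\cdot,p_i)$ are extended by $0$ outside $\Omega_i$, and for $x\in E$ and $r>0$ small enough (so that $p_1,p_2\notin \overline{B(x,r)}$), $$J(x,r)=\left(\frac1{r^2}\int_{B(x,r)}|\nabla u_1(y)|^2\,dy\right)\left(\frac1{r^2}\int_{B(x,r)}|\nabla u_2(y)|^2\,dy\right).$$ *)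

theory Defs
  imports "HOL-Probability.Probability_Measure"
begin

type_synonym plane = "real ^ 2"

definition domain :: "plane set \<Rightarrow> bool" where
  "domain \<Omega> \<longleftrightarrow> open \<Omega> \<and> connected \<Omega> \<and> \<Omega> \<noteq> {}"


subsection \<open>One-dimensional Hausdorff measure and rectifiability\<close>

text \<open>The covering sets have to be required bounded, since \<^const>\<open>diameter\<close> is unspecified
  on unbounded sets. Empty covering sets have diameter 0, so finite covers are included.\<close>

definition hausdorff1_content :: "real \<Rightarrow> plane set \<Rightarrow> ennreal" where
  "hausdorff1_content \<delta> A =
     (INF C \<in> {C :: nat \<Rightarrow> plane set. A \<subseteq> (\<Union>i. C i) \<and> (\<forall>i. bounded (C i) \<and> diameter (C i) \<le> \<delta>)}.
        \<Sum>i. ennreal (diameter (C i)))"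

definition hausdorff1 :: "plane set \<Rightarrow> ennreal" where
  "hausdorff1 A = (SUP \<delta> \<in> {0<..}. hausdorff1_content \<delta> A)"

definition rectifiable1 :: "plane set \<Rightarrow> bool" where
  "rectifiable1 F \<longleftrightarrow>
     (\<exists>f :: nat \<Rightarrow> real \<Rightarrow> plane. (\<forall>i. \<exists>L. L-lipschitz_on UNIV (f i)) \<and>
        hausdorff1 (F - (\<Union>i. range (f i))) = 0)"


subsection \<open>Harmonic functions and the Dirichlet problem\<close>

text \<open>\<open>G\<close> is the gradient and \<open>H\<close> the Hessian of \<open>u\<close>: on the open set \<open>\<Omega>\<close>, \<open>u\<close> is
  twice continuously differentiable with vanishing Laplacian (the trace of \<open>H\<close>).\<close>

definition harmonic_on :: "plane set \<Rightarrow> (plane \<Rightarrow> real) \<Rightarrow> bool" where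
  "harmonic_on \<Omega> u \<longleftrightarrow>
     (\<exists>(G :: plane \<Rightarrow> plane) (H :: plane \<Rightarrow> plane \<Rightarrow>\<^sub>L plane).
        continuous_on \<Omega> H \<and>
        (\<forall>x\<in>\<Omega>. GDERIV u x :> G x \<and> (G has_derivative blinfun_apply (H x)) (at x) \<and>
               (\<Sum>b\<in>Basis. blinfun_apply (H x) b \<bullet> b) = 0))"

text \<open>The boundedness condition on \<open>u\<close> only matters for unbounded \<open>\<Omega>\<close>, where it is the usual
  condition at infinity that makes the solution unique.\<close>

definition dirichlet_solution :: "plane set \<Rightarrow> (plane \<Rightarrow> real) \<Rightarrow> (plane \<Rightarrow> real) \<Rightarrow> bool" where
  "dirichlet_solution \<Omega> f u \<longleftrightarrow>
     continuous_on (closure \<Omega>) u \<and> bounded (u ` closure \<Omega>) \<and> harmonic_on \<Omega> u \<and>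
     (\<forall>x\<in>frontier \<Omega>. u x = f x)"

definition wiener_regular :: "plane set \<Rightarrow> bool" where
  "wiener_regular \<Omega> \<longleftrightarrow>
     (\<forall>f. continuous_on (frontier \<Omega>) f \<and> bounded (f ` frontier \<Omega>) \<longrightarrow>
          (\<exists>u. dirichlet_solution \<Omega> f u))"

text \<open>Harmonic measure and Green function are only used for Wiener regular domains; there
  these predicates determine the measure, respectively the function on \<open>\<Omega> - {p}\<close>, uniquely.\<close>

definition harmonic_measure :: "plane set \<Rightarrow> plane \<Rightarrow> plane measure \<Rightarrow> bool" where
  "harmonic_measure \<Omega> p \<omega> \<longleftrightarrow>
     prob_space \<omega> \<and> sets \<omega> = sets borel \<and> emeasure \<omega> (- frontier \<Omega>) = 0 \<and>
     (\<forall>f u. continuous_on (frontier \<Omega>) f \<and> bounded (f ` frontier \<Omega>) \<and> dirichlet_solution \<Omega> f u \<longrightarrow>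
          u p = (\<integral>y. indicator (frontier \<Omega>) y * f y \<partial>\<omega>))"

text \<open>Normalised by \<open>-\<Delta>g = \<delta>\<^sub>p\<close>. Boundedness away from the pole is automatic for bounded
  \<open>\<Omega>\<close> and is the usual condition at infinity otherwise.\<close>

definition green_function :: "plane set \<Rightarrow> plane \<Rightarrow> (plane \<Rightarrow> real) \<Rightarrow> bool" where
  "green_function \<Omega> p g \<longleftrightarrow>
     (\<exists>h. harmonic_on \<Omega> h \<and> (\<forall>x\<in>\<Omega> - {p}. g x = h x - ln (dist x p) / (2 * pi))) \<and>
     (\<forall>z\<in>frontier \<Omega>. (g \<longlongrightarrow> 0) (at z within \<Omega>)) \<and>
     (\<forall>r>0. bounded (g ` (\<Omega> - ball p r)))"


subsection \<open>The Alt-Caffarelli-Friedman functional\<close>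

definition zero_extension :: "plane set \<Rightarrow> (plane \<Rightarrow> real) \<Rightarrow> plane \<Rightarrow> real" where
  "zero_extension \<Omega> g = (\<lambda>x. if x \<in> \<Omega> then g x else 0)"

text \<open>For a Green function extended by zero, this pointwise gradient represents the weak
  gradient away from the pole: the two agree off \<open>frontier \<Omega>\<close>, which is Lebesgue null
  when it is rectifiable.\<close>

definition gradient :: "(plane \<Rightarrow> real) \<Rightarrow> plane \<Rightarrow> plane" where
  "gradient u x = (if \<exists>D. GDERIV u x :> D then (THE D. GDERIV u x :> D) else 0)"

text \<open>Values in \<^typ>\<open>ennreal\<close>, so that a divergent integral counts as \<open>\<infinity>\<close> and not as 0.\<close>

definition mean_energy :: "(plane \<Rightarrow> real) \<Rightarrow> plane \<Rightarrow> real \<Rightarrow> ennreal" where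
  "mean_energy u x r =
     (\<integral>\<^sup>+ y \<in> ball x r. ennreal ((norm (gradient u y))\<^sup>2) \<partial>lebesgue) / ennreal (r\<^sup>2)"

definition acf_functional ::
    "(plane \<Rightarrow> real) \<Rightarrow> (plane \<Rightarrow> real) \<Rightarrow> plane \<Rightarrow> real \<Rightarrow> ennreal" where
  "acf_functional u\<^sub>1 u\<^sub>2 x r = mean_energy u\<^sub>1 x r * mean_energy u\<^sub>2 x r"

end

theory Submission
  imports Defs "HOL-Complex_Analysis.Complex_Analysis" "HOL-Probability.Sinc_Integral"
begin

text \<open>For \<open>s = 1\<close> and \<open>s = -1\<close> let \<open>\<Omega>\<close> be the image of the right half-plane under the conformal map
  \<open>V \<mapsto> exp (s \<i> Ln (Ln V + 3 \<i>))\<close>. The inner logarithm maps onto a strip at height about 3, and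
  \<open>exp (s \<i> Ln w)\<close> has modulus \<open>exp (- s arg w)\<close> and argument \<open>s ln |w|\<close>, so it winds the two
  ends of the strip infinitely often around circles: as \<open>V \<rightarrow> \<infinity>\<close> the image spirals towards the unit
  circle, from inside for \<open>s = 1\<close> and from outside for \<open>s = -1\<close>. Hence \<open>E\<close> is the unit circle, and it
  is the impression of a single prime end of either domain, so harmonic measure does not see it:
  harmonic measure is the image of arc length on the circle, which is carried by the two spirals
  bounding \<open>\<Omega>\<close>. Bounded distances in the strip become negligible near \<open>E\<close> because \<open>ln |w|\<close> varies
  slowly; this makes the Poisson integral attain continuous boundary values also on \<open>E\<close>. Finally the
  gradient of the Green function decays like \<open>ln |V| / |V|\<close>, so it tends to 0 at \<open>E\<close>.\<close>

subsection \<open>The plane as the complex numbers\<close>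

text \<open>The obstacle is regularity on E. As V tends to infinity the map has no limit, since its
  images accumulate at the whole circle; so it does not extend continuously to a closed disc, and
  boundary values on E cannot be read off from an extension. Scale invariance of the half-plane
  takes its place: seen from V, harmonic measure is carried, up to small mass, by boundary points
  whose modulus is comparable to |V|. The inner logarithm turns comparable moduli into bounded
  distance, and the outer one makes bounded distance, far out in the strip, vanish.

  Harmonic measure is characterised through all solutions of the Dirichlet problem, not just the
  constructed ones. Hence an arbitrary C^2 harmonic function must be brought into holomorphic form
  before it can be pulled back by the conformal map.

  The other end of the strip, V near 0, spirals towards the circle of radius
  \<open>exp (- s * pi)\<close>. That circle lies strictly on one side of the unit circle, so it
  does not meet E, but it has to be carried along in the treatment of the frontier.\<close>

definition to_plane :: "complex \<Rightarrow> plane" where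
  "to_plane z = vector [Re z, Im z]"

definition of_plane :: "plane \<Rightarrow> complex" where
  "of_plane x = Complex (vec_nth x 1) (vec_nth x 2)"

lemma of_plane_to_plane [simp]: "of_plane (to_plane z) = z"
  by (simp add: of_plane_def to_plane_def)

lemma to_plane_of_plane [simp]: "to_plane (of_plane x) = x"
  by (simp add: of_plane_def to_plane_def vec_eq_iff forall_2)

lemma linear_to_plane: "linear to_plane"
  by (rule linearI) (auto simp: to_plane_def vec_eq_iff forall_2)

lemma linear_of_plane: "linear of_plane"
  by (rule linearI) (auto simp: of_plane_def complex_eq_iff)

lemmas bounded_linear_to_plane = linear_conv_bounded_linear[THEN iffD1, OF linear_to_plane]
lemmas bounded_linear_of_plane = linear_conv_bounded_linear[THEN iffD1, OF linear_of_plane]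

lemma norm_of_plane [simp]: "norm (of_plane x) = norm x"
  by (simp add: of_plane_def norm_vec_def L2_set_def sum_2 cmod_def)

lemma norm_to_plane [simp]: "norm (to_plane z) = norm z"
  by (metis norm_of_plane of_plane_to_plane)

lemma dist_to_plane [simp]: "dist (to_plane z) (to_plane w) = dist z w"
  by (simp add: dist_norm flip: linear_diff[OF linear_to_plane])

lemma bij_to_plane: "bij to_plane"
  by (rule bijI') (metis of_plane_to_plane, metis to_plane_of_plane)

lemma inj_to_plane: "inj to_plane"
  using bij_to_plane bij_is_inj by blast

lemma to_plane_image_iff [simp]: "to_plane z \<in> to_plane ` S \<longleftrightarrow> z \<in> S"
  by (simp add: inj_image_mem_iff inj_to_plane)

lemma to_plane_image_iff': "x \<in> to_plane ` S \<longleftrightarrow> of_plane x \<in> S"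
  by (metis to_plane_image_iff to_plane_of_plane)

lemma inner_to_plane: "to_plane z \<bullet> to_plane w = Re (z * cnj w)"
  by (simp add: to_plane_def inner_vec_def sum_2)

lemma continuous_on_to_plane [continuous_intros]:
  "continuous_on S f \<Longrightarrow> continuous_on S (\<lambda>x. to_plane (f x))"
  using bounded_linear.continuous_on[OF bounded_linear_to_plane] .

lemma continuous_on_of_plane [continuous_intros]:
  "continuous_on S f \<Longrightarrow> continuous_on S (\<lambda>x. of_plane (f x))"
  using bounded_linear.continuous_on[OF bounded_linear_of_plane] .

lemma tendsto_to_plane [tendsto_intros]:
  "(f \<longlongrightarrow> l) F \<Longrightarrow> ((\<lambda>x. to_plane (f x)) \<longlongrightarrow> to_plane l) F"
  using bounded_linear.tendsto[OF bounded_linear_to_plane] .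

lemma tendsto_of_plane [tendsto_intros]:
  "(f \<longlongrightarrow> l) F \<Longrightarrow> ((\<lambda>x. of_plane (f x)) \<longlongrightarrow> of_plane l) F"
  using bounded_linear.tendsto[OF bounded_linear_of_plane] .

lemma closure_to_plane: "closure (to_plane ` S) = to_plane ` closure S"
  by (rule closure_injective_linear_image[symmetric, OF linear_to_plane inj_to_plane])

lemma open_to_plane: "open S \<Longrightarrow> open (to_plane ` S)"
proof -
  assume "open S"
  have "to_plane ` S = of_plane -` S" by (auto simp: to_plane_image_iff')
  thus ?thesis
    using \<open>open S\<close> continuous_on_open_vimage[of UNIV of_plane] continuous_on_of_plane[OF continuous_on_id]
    by auto
qed

lemma frontier_to_plane: "open S \<Longrightarrow> frontier (to_plane ` S) = to_plane ` frontier S"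
  by (simp add: frontier_def closure_to_plane interior_open open_to_plane image_set_diff inj_to_plane)

lemma sum_Basis_plane:
  "(\<Sum>b\<in>Basis. f (b::plane)) = f (to_plane 1) + f (to_plane \<i>)"
proof -
  have B: "(Basis :: plane set) = {to_plane 1, to_plane \<i>}"
  proof -
    have "axis 1 1 = to_plane 1" "axis 2 1 = to_plane \<i>"
      by (auto simp: to_plane_def vec_eq_iff forall_2 axis_def)
    thus ?thesis by (auto simp: Basis_vec_def UNIV_2)
  qed
  have "to_plane 1 \<noteq> to_plane \<i>" by (metis of_plane_to_plane complex_i_not_one)
  thus ?thesis by (simp add: B)
qed

subsection \<open>Harmonic functions\<close>

text \<open>Real differentials are kept in the form \<open>Re (q * h)\<close> with q = u_x - \<i>
  u_y. In this form composition with a holomorphic map just multiplies q by a derivative, and the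
  gradient is the conjugate of q because the inner product of the plane is
  \<open>Re (z * cnj w)\<close>.\<close>

lemma gderiv_to_plane:
  assumes "(u has_derivative (\<lambda>h. Re (q * h))) (at z)"
  shows "GDERIV (\<lambda>x. u (of_plane x)) (to_plane z) :> to_plane (cnj q)"
proof -
  have "((\<lambda>x. u (of_plane x)) has_derivative (\<lambda>h. Re (q * of_plane h))) (at (to_plane z))"
    by (rule has_derivative_compose[OF bounded_linear_imp_has_derivative[OF bounded_linear_of_plane]])
      (use assms in simp)
  moreover have "h \<bullet> to_plane (cnj q) = Re (q * of_plane h)" for h
    using inner_to_plane[of "of_plane h" "cnj q"] by (simp add: mult.commute)
  ultimately show ?thesis by (simp add: gderiv_def)
qed

lemma harmonic_on_Re:
  assumes S: "open S" and f: "f holomorphic_on S"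
  shows "harmonic_on (to_plane ` S) (\<lambda>x. Re (f (of_plane x)))"
  unfolding harmonic_on_def
proof (intro exI conjI ballI)
  let ?G = "\<lambda>x. to_plane (cnj (deriv f (of_plane x)))"
  let ?h = "\<lambda>c h. to_plane (cnj (c * of_plane h))"
  have bl: "bounded_linear (?h c)" for c
    by (rule bounded_linear_compose[OF bounded_linear_to_plane]
          bounded_linear_compose[OF bounded_linear_cnj]
          bounded_linear_compose[OF bounded_linear_mult_right] bounded_linear_of_plane)+
  let ?H = "\<lambda>x. Blinfun (?h (deriv (deriv f) (of_plane x)))"
  have app: "blinfun_apply (Blinfun (?h c)) = ?h c" for c
    by (rule bounded_linear_Blinfun_apply[OF bl])
  \<comment> \<open>The Hessian depends on the coefficient \<open>c\<close> in a bounded linear way,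
    so its continuity is inherited from the second derivative of \<open>f\<close>.\<close>
  have bl2: "bounded_linear (\<lambda>c. Blinfun (?h c))"
  proof (rule bounded_linear_intro[where K=1])
    show "Blinfun (?h (x + y)) = Blinfun (?h x) + Blinfun (?h y)" for x y
      by (rule blinfun_eqI) (simp only: app blinfun.add_left, simp add: distrib_right linear_add[OF linear_to_plane])
    show "Blinfun (?h (r *\<^sub>R x)) = r *\<^sub>R Blinfun (?h x)" for r x
      by (rule blinfun_eqI) (simp only: app blinfun.scaleR_left, simp add: linear_cmul[OF linear_to_plane, symmetric])
    show "norm (Blinfun (?h x)) \<le> norm x * 1" for x
      by (rule norm_blinfun_bound) (simp_all only: app, simp_all add: norm_mult)
  qed
  have f': "deriv f holomorphic_on S" using f S holomorphic_deriv by blast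
  have f'': "deriv (deriv f) holomorphic_on S" using f' S holomorphic_deriv by blast
  show "continuous_on (to_plane ` S) ?H"
    by (rule bounded_linear.continuous_on[OF bl2],
        rule continuous_on_compose2[OF holomorphic_on_imp_continuous_on[OF f'']])
      (auto intro!: continuous_intros)
  fix x assume "x \<in> to_plane ` S"
  then obtain z where z: "x = to_plane z" "z \<in> S" by auto
  have "(f has_derivative (\<lambda>h. deriv f z * h)) (at z)"
    using holomorphic_derivI[OF f S z(2)] by (simp add: has_field_derivative_def)
  hence "((\<lambda>z. Re (f z)) has_derivative (\<lambda>h. Re (deriv f z * h))) (at z)"
    by (rule has_derivative_Re)
  from gderiv_to_plane[OF this] show "GDERIV (\<lambda>x. Re (f (of_plane x))) x :> ?G x"
    by (simp add: z)
  have "(deriv f has_derivative (\<lambda>h. deriv (deriv f) z * h)) (at z)"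
    using holomorphic_derivI[OF f' S z(2)] by (simp add: has_field_derivative_def)
  hence "(deriv f has_derivative (\<lambda>h. deriv (deriv f) z * h)) (at (of_plane x))"
    by (simp add: z)
  from has_derivative_compose[OF bounded_linear_imp_has_derivative[OF bounded_linear_of_plane] this]
  have "((\<lambda>x. deriv f (of_plane x)) has_derivative (\<lambda>h. deriv (deriv f) z * of_plane h)) (at x)"
    by simp
  from bounded_linear.has_derivative[OF bounded_linear_compose[OF bounded_linear_to_plane bounded_linear_cnj] this]
  show "(?G has_derivative blinfun_apply (?H x)) (at x)"
    by (simp only: app) (simp add: z)
  \<comment> \<open>With c the second derivative of \<open>f\<close>, the two basis vectors
    contribute Re c and - Re c.\<close>
  show "(\<Sum>b\<in>Basis. blinfun_apply (?H x) b \<bullet> b) = 0"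
    by (simp only: app sum_Basis_plane inner_to_plane) simp
qed

text \<open>The second difference is symmetric in \<open>a\<close> and \<open>b\<close>, which forces the Hessian to be symmetric.\<close>

lemma second_difference:
  fixes u :: "'a::euclidean_space \<Rightarrow> real"
  assumes t: "0 < t" and ab: "t * (norm a + norm b) < r"
    and u: "\<And>y. y \<in> ball x r \<Longrightarrow> GDERIV u y :> G y"
    and G: "\<And>y. y \<in> ball x r \<Longrightarrow> (G has_derivative blinfun_apply (H y)) (at y)"
  shows "\<exists>y. dist x y \<le> t * (norm a + norm b) \<and>
     u (x + t *\<^sub>R a + t *\<^sub>R b) - u (x + t *\<^sub>R a) - u (x + t *\<^sub>R b) + u x
     = t * t * (blinfun_apply (H y) b \<bullet> a)"
proof -
  have nb: "norm (s *\<^sub>R a + s' *\<^sub>R b) \<le> t * (norm a + norm b)" if "\<bar>s\<bar> \<le> t" "\<bar>s'\<bar> \<le> t" for s s'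
  proof -
    have "norm (s *\<^sub>R a + s' *\<^sub>R b) \<le> \<bar>s\<bar> * norm a + \<bar>s'\<bar> * norm b"
      by (rule order_trans[OF norm_triangle_ineq]) simp
    also have "\<dots> \<le> t * norm a + t * norm b"
      using that by (intro add_mono mult_right_mono) auto
    finally show ?thesis by (simp add: algebra_simps)
  qed
  have db: "x + s *\<^sub>R a + s' *\<^sub>R b \<in> ball x r" "dist x (x + s *\<^sub>R a + s' *\<^sub>R b) \<le> t * (norm a + norm b)"
    if "\<bar>s\<bar> \<le> t" "\<bar>s'\<bar> \<le> t" for s s'
  proof -
    have "dist x (x + s *\<^sub>R a + s' *\<^sub>R b) = norm (s *\<^sub>R a + s' *\<^sub>R b)"
      unfolding dist_norm by (subst norm_minus_commute) (simp add: algebra_simps)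
    with nb[OF that] ab show "x + s *\<^sub>R a + s' *\<^sub>R b \<in> ball x r"
      "dist x (x + s *\<^sub>R a + s' *\<^sub>R b) \<le> t * (norm a + norm b)" by auto
  qed
  have path: "((\<lambda>s. u (p + s *\<^sub>R a)) has_real_derivative (G (p + s *\<^sub>R a) \<bullet> a)) (at s)"
    if "p + s *\<^sub>R a \<in> ball x r" for p s
  proof -
    have "((\<lambda>s. u (p + s *\<^sub>R a)) has_derivative (\<lambda>h. (h *\<^sub>R a) \<bullet> G (p + s *\<^sub>R a))) (at s)"
      using u[OF that] unfolding gderiv_def
      by (rule has_derivative_compose[rotated]) (auto intro!: derivative_eq_intros)
    thus ?thesis by (simp add: has_field_derivative_def inner_commute mult_commute_abs)
  qed
  \<comment> \<open>The mean value theorem is used twice: for the increment in direction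
    \<open>b\<close> while moving along \<open>a\<close>, then for the \<open>a\<close>-component of
    \<open>G\<close> while moving along \<open>b\<close>.\<close>
  let ?f = "\<lambda>s. u (x + t *\<^sub>R b + s *\<^sub>R a) - u (x + s *\<^sub>R a)"
  have "\<exists>s>0. s < t \<and> ?f t - ?f 0 = (t - 0) * ((G (x + t *\<^sub>R b + s *\<^sub>R a) \<bullet> a) - (G (x + s *\<^sub>R a) \<bullet> a))"
  proof (rule MVT2[OF t])
    fix s assume s: "0 \<le> s" "s \<le> t"
    have "x + t *\<^sub>R b + s *\<^sub>R a \<in> ball x r" "x + s *\<^sub>R a \<in> ball x r"
      using db[of s t] db[of s 0] s t by (auto simp: algebra_simps)
    thus "(?f has_real_derivative ((G (x + t *\<^sub>R b + s *\<^sub>R a) \<bullet> a) - (G (x + s *\<^sub>R a) \<bullet> a))) (at s)"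
      by (intro DERIV_diff path)
  qed
  then obtain s where s: "0 < s" "s < t" and
    1: "?f t - ?f 0 = t * ((G (x + t *\<^sub>R b + s *\<^sub>R a) \<bullet> a) - (G (x + s *\<^sub>R a) \<bullet> a))" by auto
  let ?g = "\<lambda>s'. G (x + s *\<^sub>R a + s' *\<^sub>R b) \<bullet> a"
  have "\<exists>s'>0. s' < t \<and> ?g t - ?g 0 = (t - 0) * (blinfun_apply (H (x + s *\<^sub>R a + s' *\<^sub>R b)) b \<bullet> a)"
  proof (rule MVT2[OF t])
    fix s' assume s': "0 \<le> s'" "s' \<le> t"
    have "x + s *\<^sub>R a + s' *\<^sub>R b \<in> ball x r" using db[of s s'] s s' by auto
    from G[OF this]
    have "((\<lambda>s'. G (x + s *\<^sub>R a + s' *\<^sub>R b)) has_derivative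
        (\<lambda>h. blinfun_apply (H (x + s *\<^sub>R a + s' *\<^sub>R b)) (h *\<^sub>R b))) (at s')"
      by (rule has_derivative_compose[rotated]) (auto intro!: derivative_eq_intros)
    from has_derivative_inner_left[OF this, of a]
    show "(?g has_real_derivative (blinfun_apply (H (x + s *\<^sub>R a + s' *\<^sub>R b)) b \<bullet> a)) (at s')"
      by (simp add: has_field_derivative_def blinfun.scaleR_right mult_commute_abs)
  qed
  then obtain s' where s': "0 < s'" "s' < t" and
    2: "?g t - ?g 0 = t * (blinfun_apply (H (x + s *\<^sub>R a + s' *\<^sub>R b)) b \<bullet> a)" by auto
  show ?thesis
  proof (intro exI conjI)
    show "dist x (x + s *\<^sub>R a + s' *\<^sub>R b) \<le> t * (norm a + norm b)" using db s s' by auto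
    have "u (x + t *\<^sub>R a + t *\<^sub>R b) - u (x + t *\<^sub>R a) - u (x + t *\<^sub>R b) + u x = ?f t - ?f 0"
      by (simp add: algebra_simps)
    also have "\<dots> = t * (?g t - ?g 0)" unfolding 1 by (simp add: algebra_simps)
    finally show "u (x + t *\<^sub>R a + t *\<^sub>R b) - u (x + t *\<^sub>R a) - u (x + t *\<^sub>R b) + u x
      = t * t * (blinfun_apply (H (x + s *\<^sub>R a + s' *\<^sub>R b)) b \<bullet> a)"
      unfolding 2 by simp
  qed
qed

text \<open>Schwarz's theorem. The two mean value expressions for the same second difference agree
  at intermediate points that shrink to \<open>x\<close>, where \<open>H\<close> is
  continuous.\<close>

lemma hessian_symmetric:
  fixes u :: "'a::euclidean_space \<Rightarrow> real"
  assumes S: "open S" "x \<in> S" and H: "continuous_on S H"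
    and u: "\<And>y. y \<in> S \<Longrightarrow> GDERIV u y :> G y"
    and G: "\<And>y. y \<in> S \<Longrightarrow> (G has_derivative blinfun_apply (H y)) (at y)"
  shows "blinfun_apply (H x) a \<bullet> b = blinfun_apply (H x) b \<bullet> a"
proof -
  obtain r where r: "r > 0" "ball x r \<subseteq> S" using S openE by blast
  \<comment> \<open>The summand 1 keeps \<open>K\<close> positive when both vectors vanish; the
    steps \<open>t n\<close> keep all intermediate points inside the ball and tend to 0.\<close>
  define K where "K = norm a + norm b + 1"
  define t where "t n = r / (K * (real n + 2))" for n
  have K: "K > 0" unfolding K_def by (smt (verit) norm_ge_zero)
  have t0: "t n > 0" for n using r K by (simp add: t_def)
  have tr: "t n * (norm a + norm b) < r" for n
  proof -
    have "t n * (norm a + norm b) < t n * K" using t0[of n] by (simp add: K_def)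
    also have "\<dots> = r / (real n + 2)" using K by (simp add: t_def)
    also have "\<dots> \<le> r" using r by (simp add: field_simps)
    finally show ?thesis .
  qed
  have tl: "(\<lambda>n. t n * (norm a + norm b)) \<longlonglongrightarrow> 0"
  proof -
    have "(\<lambda>n. inverse (real n + 2)) \<longlonglongrightarrow> 0" by real_asymp
    from tendsto_mult_left_zero[OF this, of "r * (norm a + norm b) / K"]
    show ?thesis by (simp add: t_def field_simps)
  qed
  have ux: "\<And>y. y \<in> ball x r \<Longrightarrow> GDERIV u y :> G y" using u r by blast
  have Gx: "\<And>y. y \<in> ball x r \<Longrightarrow> (G has_derivative blinfun_apply (H y)) (at y)" using G r by blast
  obtain y where y: "\<And>n. dist x (y n) \<le> t n * (norm a + norm b)"
    "\<And>n. u (x + t n *\<^sub>R a + t n *\<^sub>R b) - u (x + t n *\<^sub>R a) - u (x + t n *\<^sub>R b) + u x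
     = t n * t n * (blinfun_apply (H (y n)) b \<bullet> a)"
    using second_difference[OF t0 tr ux Gx] by metis
  have tr': "t n * (norm b + norm a) < r" for n using tr by (simp add: add.commute)
  obtain z where z: "\<And>n. dist x (z n) \<le> t n * (norm b + norm a)"
    "\<And>n. u (x + t n *\<^sub>R b + t n *\<^sub>R a) - u (x + t n *\<^sub>R b) - u (x + t n *\<^sub>R a) + u x
     = t n * t n * (blinfun_apply (H (z n)) a \<bullet> b)"
    using second_difference[OF t0 tr' ux Gx] by metis
  have eq: "blinfun_apply (H (y n)) b \<bullet> a = blinfun_apply (H (z n)) a \<bullet> b" for n
  proof -
    have "t n * t n * (blinfun_apply (H (y n)) b \<bullet> a) = t n * t n * (blinfun_apply (H (z n)) a \<bullet> b)"
      unfolding y(2)[symmetric] z(2)[symmetric] by (simp add: algebra_simps)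
    thus ?thesis using t0[of n] by simp
  qed
  have cont: "isCont H x" using H S by (simp add: continuous_on_eq_continuous_at)
  have "y \<longlonglongrightarrow> x"
    using Lim_null_comparison[OF _ tl, of "\<lambda>n. y n - x"] y(1)
    by (simp add: dist_norm norm_minus_commute LIM_zero_iff)
  hence 1: "(\<lambda>n. blinfun_apply (H (y n)) b \<bullet> a) \<longlonglongrightarrow> blinfun_apply (H x) b \<bullet> a"
    by (intro tendsto_intros isCont_tendsto_compose[OF cont])
  have "z \<longlonglongrightarrow> x"
    using Lim_null_comparison[OF _ tl, of "\<lambda>n. z n - x"] z(1)
    by (simp add: dist_norm norm_minus_commute LIM_zero_iff add.commute)
  hence 2: "(\<lambda>n. blinfun_apply (H (z n)) a \<bullet> b) \<longlonglongrightarrow> blinfun_apply (H x) a \<bullet> b"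
    by (intro tendsto_intros isCont_tendsto_compose[OF cont])
  show ?thesis by (rule LIMSEQ_unique[OF 2 1[unfolded eq]])
qed

text \<open>The conjugate of the gradient satisfies the Cauchy-Riemann equations: one of them is the
  vanishing trace of the Hessian, the other its symmetry. This gives access to an arbitrary solution
  of the Dirichlet problem, about which nothing else is known.\<close>

lemma harmonic_onE:
  assumes S: "open S" and u: "harmonic_on (to_plane ` S) u"
  obtains q where "q holomorphic_on S"
    "\<And>z. z \<in> S \<Longrightarrow> ((\<lambda>z. u (to_plane z)) has_derivative (\<lambda>h. Re (q z * h))) (at z)"
proof -
  obtain G H where H: "continuous_on (to_plane ` S) H"
    and uG: "\<And>x. x \<in> to_plane ` S \<Longrightarrow> GDERIV u x :> G x"
    and GH: "\<And>x. x \<in> to_plane ` S \<Longrightarrow> (G has_derivative blinfun_apply (H x)) (at x)"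
    and tr: "\<And>x. x \<in> to_plane ` S \<Longrightarrow> (\<Sum>b\<in>Basis. blinfun_apply (H x) b \<bullet> b) = 0"
    using u unfolding harmonic_on_def by blast
  define q where "q z = cnj (of_plane (G (to_plane z)))" for z
  show ?thesis
  proof (rule that[of q])
    show "((\<lambda>z. u (to_plane z)) has_derivative (\<lambda>h. Re (q z * h))) (at z)" if "z \<in> S" for z
    proof -
      have "(u has_derivative (\<lambda>h. h \<bullet> G (to_plane z))) (at (to_plane z))"
        using uG that by (simp add: gderiv_def)
      from has_derivative_compose[OF bounded_linear_imp_has_derivative[OF bounded_linear_to_plane] this]
      have "((\<lambda>z. u (to_plane z)) has_derivative (\<lambda>h. to_plane h \<bullet> G (to_plane z))) (at z)" .
      moreover have "to_plane h \<bullet> G (to_plane z) = Re (q z * h)" for h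
        using inner_to_plane[of h "of_plane (G (to_plane z))"] by (simp add: q_def mult.commute)
      ultimately show ?thesis by simp
    qed
    show "q holomorphic_on S"
    proof (rule holomorphic_onI)
      fix z assume z: "z \<in> S"
      define A where "A h = blinfun_apply (H (to_plane z)) (to_plane h)" for h
      have lin: "linear A"
        unfolding A_def using bounded_linear_compose[OF blinfun.bounded_linear_right bounded_linear_to_plane]
        using bounded_linear.linear by blast
      have "(G has_derivative blinfun_apply (H (to_plane z))) (at (to_plane z))"
        using GH z by simp
      from has_derivative_compose[OF bounded_linear_imp_has_derivative[OF bounded_linear_to_plane] this]
      have "((\<lambda>z. G (to_plane z)) has_derivative A) (at z)" by (simp add: A_def[abs_def])
      from bounded_linear.has_derivative[OF bounded_linear_compose[OF bounded_linear_cnj bounded_linear_of_plane] this]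
      have q': "(q has_derivative (\<lambda>h. cnj (of_plane (A h)))) (at z)"
        unfolding q_def[abs_def] .
      define a where "a = of_plane (A 1)"
      define b where "b = of_plane (A \<i>)"
      \<comment> \<open>\<open>a\<close> and \<open>b\<close> are the columns of the Hessian read as
        complex numbers. Trace zero and symmetry together say \<open>cnj b = \<i> * cnj a\<close>,
        which is complex linearity of the differential of \<open>q\<close>.\<close>
      have "Re a + Im b = 0"
        using tr[of "to_plane z"] z unfolding sum_Basis_plane A_def[symmetric]
        using inner_to_plane[of a 1] inner_to_plane[of b \<i>] by (simp add: a_def b_def)
      moreover have "A 1 \<bullet> to_plane \<i> = A \<i> \<bullet> to_plane 1"
        unfolding A_def
        by (rule hessian_symmetric[OF open_to_plane[OF S] _ H uG GH]) (use z in auto)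
      hence "Im a = Re b"
        using inner_to_plane[of a \<i>] inner_to_plane[of b 1] by (simp add: a_def b_def)
      ultimately have b: "cnj b = \<i> * cnj a" by (simp add: complex_eq_iff)
      have "cnj (of_plane (A h)) = cnj a * h" for h
      proof -
        have "A h = Re h *\<^sub>R A 1 + Im h *\<^sub>R A \<i>"
          using linear_add[OF lin, of "Re h *\<^sub>R 1" "Im h *\<^sub>R \<i>"] linear_cmul[OF lin]
          by (metis complex_eq mult.commute scaleR_conv_of_real mult.right_neutral)
        hence "of_plane (A h) = Re h *\<^sub>R a + Im h *\<^sub>R b"
          by (simp add: a_def b_def linear_add[OF linear_of_plane] linear_cmul[OF linear_of_plane])
        hence "cnj (of_plane (A h)) = Re h *\<^sub>R cnj a + Im h *\<^sub>R cnj b" by simp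
        also have "\<dots> = cnj a * h" unfolding b
          by (simp add: complex_eq_iff algebra_simps)
        finally show ?thesis .
      qed
      with q' have "(q has_field_derivative cnj a) (at z)"
        by (simp add: has_field_derivative_def)
      thus "q field_differentiable at z within S"
        using field_differentiable_at_within field_differentiable_def by blast
    qed
  qed
qed

subsection \<open>Poisson integrals on the half-plane and mean values on the disc\<close>

definition cauchy_measure :: "real measure" where
  "cauchy_measure = density lborel (\<lambda>s. ennreal (1 / (pi * (1 + s\<^sup>2))))"

lemma sets_cauchy_measure [measurable_cong, simp]: "sets cauchy_measure = sets borel"
  by (simp add: cauchy_measure_def)

lemma space_cauchy_measure [simp]: "space cauchy_measure = UNIV"
  by (simp add: cauchy_measure_def)

lemma prob_space_cauchy: "prob_space cauchy_measure"
proof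
  have i: "integrable lborel (\<lambda>x::real. inverse (1 + x\<^sup>2))"
    using integrable_inverse_1_plus_square by (simp add: set_integrable_def)
  have "(\<integral>x. inverse (1 + x\<^sup>2) \<partial>lborel) = pi"
    using LBINT_inverse_1_plus_square by (simp add: interval_lebesgue_integral_def set_lebesgue_integral_def)
  hence v: "(\<integral>x. 1 / (pi * (1 + x\<^sup>2)) \<partial>lborel) = 1"
    using Bochner_Integration.integral_mult_right_zero[of lborel "1/pi" "\<lambda>x. inverse (1 + x\<^sup>2)"]
    by (simp add: field_simps)
  have i': "integrable lborel (\<lambda>x::real. 1 / (pi * (1 + x\<^sup>2)))"
    using integrable_mult_right[OF i, of "1/pi"] by (simp add: field_simps)
  show "emeasure cauchy_measure (space cauchy_measure) = 1"
    unfolding cauchy_measure_def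
    by (subst emeasure_density) (auto simp: nn_integral_eq_integral[OF i'] v add_nonneg_nonneg)
qed

lemma AE_cauchy_finite:
  assumes "finite {s. \<not> P s}"
  shows "AE s in cauchy_measure. P s"
proof -
  have "{s. \<not> P s} \<in> null_sets lborel" using assms by (rule finite_imp_null_set_lborel)
  hence "AE s in lborel. P s" by (subst AE_iff_null) (auto intro: null_setsD2)
  thus ?thesis unfolding cauchy_measure_def by (subst AE_density) auto
qed

text \<open>The Poisson kernel of the right half-plane at \<open>V\<close> is the Cauchy distribution centred at \<open>Im V\<close>
  and scaled by \<open>Re V\<close>; in this form boundary limits follow by dominated convergence.\<close>

definition poisson :: "(real \<Rightarrow> real) \<Rightarrow> complex \<Rightarrow> real" where
  "poisson F V = (\<integral>s. F (Im V + Re V * s) \<partial>cauchy_measure)"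

lemma poisson_bound:
  assumes "F \<in> borel_measurable borel" "\<And>t. \<bar>F t\<bar> \<le> B"
  shows "\<bar>poisson F V\<bar> \<le> B"
proof -
  interpret prob_space cauchy_measure by (rule prob_space_cauchy)
  have [measurable]: "F \<in> borel_measurable borel" by fact
  have i: "integrable cauchy_measure (\<lambda>s. F (Im V + Re V * s))"
    by (rule integrable_const_bound[of _ B]) (use assms in auto)
  have "\<bar>poisson F V\<bar> \<le> (\<integral>s. \<bar>F (Im V + Re V * s)\<bar> \<partial>cauchy_measure)"
    unfolding poisson_def by (rule integral_abs_bound)
  also have "\<dots> \<le> (\<integral>s. B \<partial>cauchy_measure)"
    by (rule integral_mono) (use i assms in auto)
  finally show ?thesis using prob_space by simp
qed

text \<open>The distance from V to the imaginary axis is at least \<open>c\<close>, which absorbs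
  the constant 1 + M, and |t| exceeds |V| by at most the distance from V to \<i> t. The constant is
  the same for all V in a small ball, as needed for a dominating function.\<close>

lemma poisson_denominator_bound:
  assumes "Re V \<ge> c" "norm V \<le> M" "c > 0"
  shows "1 + \<bar>t\<bar> \<le> (1 + (1 + M) / c) * norm (V - \<i> * complex_of_real t)"
proof -
  let ?d = "norm (V - \<i> * complex_of_real t)"
  have "M \<ge> 0" using assms(2) norm_ge_zero order_trans by blast
  have "c \<le> ?d" using assms abs_Re_le_cmod[of "V - \<i> * complex_of_real t"] by simp
  hence "(1 + M) / c * c \<le> (1 + M) / c * ?d" using \<open>c > 0\<close> \<open>M \<ge> 0\<close>
    by (intro mult_left_mono) auto
  hence "1 + M \<le> (1 + M) / c * ?d" using \<open>c > 0\<close> by simp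
  moreover have "\<bar>t\<bar> \<le> norm V + ?d"
    using norm_triangle_ineq4[of V "V - \<i> * complex_of_real t"] by (simp add: norm_mult)
  ultimately show ?thesis using assms by (simp add: algebra_simps)
qed

text \<open>The Poisson kernel is the real part of a kernel holomorphic in V (Schwarz's formula),
  and the integral may be differentiated under the integral sign. Real parts of holomorphic
  functions are what can be transplanted by a conformal map.\<close>

lemma poisson_eq_Re_holomorphic:
  assumes F [measurable]: "F \<in> borel_measurable borel" and B: "\<And>t. \<bar>F t\<bar> \<le> B"
  obtains h where "h holomorphic_on {V. Re V > 0}" "\<And>V. Re V > 0 \<Longrightarrow> poisson F V = Re (h V)"
proof -
  interpret prob_space cauchy_measure by (rule prob_space_cauchy)
  \<comment> \<open>\<open>k V t / (1 + t\<^sup>2)\<close> is \<open>F t\<close> times \<open>1 / (V - \<i> t)\<close>, up to an imaginary multiple of \<open>F t\<close> that does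
    not depend on \<open>V\<close> and makes the integral converge.\<close>
  define k where "k V t = complex_of_real (F t) * ((1 - \<i> * complex_of_real t * V) / (V - \<i> * complex_of_real t))" for V t
  have k_meas [measurable]: "k V \<in> borel_measurable borel" for V unfolding k_def by measurable
  have B0: "B \<ge> 0" using B[of 0] by linarith
  have k_int: "integrable cauchy_measure (k V)" if V: "Re V > 0" for V
  proof (rule integrable_const_bound)
    define C where "C = 1 + (1 + norm V) / Re V"
    have "norm (k V t) \<le> B * ((1 + norm V) * C)" for t
    proof -
      have d: "V - \<i> * complex_of_real t \<noteq> 0" using V by (auto simp: complex_eq_iff)
      have "norm (1 - \<i> * complex_of_real t * V) \<le> 1 + \<bar>t\<bar> * norm V"
        by (rule order_trans[OF norm_triangle_ineq4]) (simp add: norm_mult)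
      also have "\<dots> \<le> (1 + norm V) * (1 + \<bar>t\<bar>)" by (simp add: algebra_simps)
      also have "\<dots> \<le> (1 + norm V) * (C * norm (V - \<i> * complex_of_real t))"
        unfolding C_def by (intro mult_left_mono poisson_denominator_bound) (use V in auto)
      finally have "norm ((1 - \<i> * complex_of_real t * V) / (V - \<i> * complex_of_real t)) \<le> (1 + norm V) * C"
        using d by (simp add: norm_divide field_simps)
      thus ?thesis unfolding k_def norm_mult
        by (intro mult_mono) (use B B0 in auto)
    qed
    thus "AE t in cauchy_measure. norm (k V t) \<le> B * ((1 + norm V) * C)" by simp
  qed simp
  define h where "h V = (\<integral>t. k V t \<partial>cauchy_measure)" for V
  have Re_h: "poisson F V = Re (h V)" if V: "Re V > 0" for V
  proof -
    define X Y where "X = Re V" and "Y = Im V"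
    have X: "X > 0" using V by (simp add: X_def)
    \<comment> \<open>The factor \<open>1 + t\<^sup>2\<close> cancels the density of
      \<open>cauchy_measure\<close> and leaves the Poisson kernel at V.\<close>
    have Rek: "Re (k V t) = F t * (X * (1 + t\<^sup>2) / (X\<^sup>2 + (t - Y)\<^sup>2))" for t
    proof -
      have "Re ((1 - \<i> * complex_of_real t * V) / (V - \<i> * complex_of_real t)) = X * (1 + t\<^sup>2) / (X\<^sup>2 + (t - Y)\<^sup>2)"
        unfolding Re_divide by (simp add: X_def Y_def power2_eq_square algebra_simps)
      moreover have "Re (complex_of_real a * z) = a * Re z" for a z by simp
      ultimately show ?thesis unfolding k_def by presburger
    qed
    have pos: "X\<^sup>2 + r\<^sup>2 > 0" for r using X by (simp add: add_pos_nonneg)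
    have pos1: "1 + r\<^sup>2 > (0::real)" for r by (simp add: add_pos_nonneg)
    have "Re (h V) = (\<integral>t. Re (k V t) \<partial>cauchy_measure)"
      unfolding h_def using k_int[OF V] by (simp add: integral_Re)
    also have "\<dots> = (\<integral>t. 1 / (pi * (1 + t\<^sup>2)) * Re (k V t) \<partial>lborel)"
      unfolding cauchy_measure_def
      by (subst integral_real_density) (auto simp: add_nonneg_nonneg)
    also have "\<dots> = (\<integral>t. F t * X / (pi * (X\<^sup>2 + (t - Y)\<^sup>2)) \<partial>lborel)"
    proof (rule Bochner_Integration.integral_cong[OF refl])
      fix t :: real
      show "1 / (pi * (1 + t\<^sup>2)) * Re (k V t) = F t * X / (pi * (X\<^sup>2 + (t - Y)\<^sup>2))"
      proof -
        have "1 / (pi * a) * (F t * (X * a / b)) = F t * X / (pi * b)" if "a > 0" "b > 0" for a b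
          using that by (simp add: divide_simps)
        from this[OF pos1[of t] pos[of "t - Y"]] show ?thesis unfolding Rek .
      qed
    qed
    \<comment> \<open>The substitution t = Y + X s centres and scales the Poisson kernel into the
      standard Cauchy density.\<close>
    also have "\<dots> = \<bar>X\<bar> *\<^sub>R (\<integral>s. F (Y + X * s) * X / (pi * (X\<^sup>2 + (Y + X * s - Y)\<^sup>2)) \<partial>lborel)"
      by (rule lborel_integral_real_affine) (use X in simp)
    also have "\<dots> = (\<integral>s. \<bar>X\<bar> *\<^sub>R (F (Y + X * s) * X / (pi * (X\<^sup>2 + (Y + X * s - Y)\<^sup>2))) \<partial>lborel)"
      by (simp only: Bochner_Integration.integral_scaleR_right)
    also have "\<dots> = (\<integral>s. 1 / (pi * (1 + s\<^sup>2)) * F (Y + X * s) \<partial>lborel)"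
    proof (rule Bochner_Integration.integral_cong[OF refl])
      fix s :: real
      have "X\<^sup>2 + (Y + X * s - Y)\<^sup>2 = X * X * (1 + s\<^sup>2)" by (simp add: power2_eq_square algebra_simps)
      thus "\<bar>X\<bar> *\<^sub>R (F (Y + X * s) * X / (pi * (X\<^sup>2 + (Y + X * s - Y)\<^sup>2))) = 1 / (pi * (1 + s\<^sup>2)) * F (Y + X * s)"
        using X pos1[of s] by simp
    qed
    also have "\<dots> = poisson F V"
      unfolding cauchy_measure_def poisson_def X_def Y_def
      by (subst integral_real_density) (auto simp: add_nonneg_nonneg)
    finally show ?thesis ..
  qed
  have "h holomorphic_on {V. Re V > 0}"
  proof (rule holomorphic_onI)
    fix V :: complex assume "V \<in> {V. Re V > 0}"
    hence V: "Re V > 0" by simp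
    define c where "c = Re V / 2"
    have c: "c > 0" using V by (simp add: c_def)
    define C where "C = 1 + (1 + (norm V + c)) / c"
    \<comment> \<open>This is exactly the difference quotient of \<open>k\<close> between W and V.
      Its two linear denominators dominate \<open>1 + t\<^sup>2\<close>, so it is bounded uniformly
      in t and in W near V.\<close>
    define D where "D W t = - complex_of_real (F t) * ((1 + complex_of_real t ^ 2) / ((W - \<i> * complex_of_real t) * (V - \<i> * complex_of_real t)))" for W t
    have inb: "Re W \<ge> c" "norm W \<le> norm V + c" if "W \<in> ball V c" for W
    proof -
      have "norm (V - W) < c" using that by (simp add: dist_norm)
      thus "Re W \<ge> c" "norm W \<le> norm V + c"
        using abs_Re_le_cmod[of "V - W"] norm_triangle_ineq2[of W V]
        by (auto simp: c_def norm_minus_commute)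
    qed
    have nz: "W - \<i> * complex_of_real t \<noteq> 0" if "Re W > 0" for W t
      using that by (auto simp: complex_eq_iff)
    have Dbound: "norm (D W t) \<le> B * (C * C)" if W: "W \<in> ball V c" for W t
    proof -
      have 1: "1 + \<bar>t\<bar> \<le> C * norm (W - \<i> * complex_of_real t)"
        unfolding C_def by (rule poisson_denominator_bound[OF inb[OF W] c])
      have 2: "1 + \<bar>t\<bar> \<le> C * norm (V - \<i> * complex_of_real t)"
        unfolding C_def by (rule poisson_denominator_bound[OF inb c]) (use c in auto)
      have "norm (1 + complex_of_real t ^ 2) \<le> 1 + \<bar>t\<bar>\<^sup>2"
        by (rule order_trans[OF norm_triangle_ineq]) (simp add: norm_power)
      also have "\<dots> \<le> (1 + \<bar>t\<bar>) * (1 + \<bar>t\<bar>)" by (simp add: algebra_simps power2_eq_square)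
      also have "\<dots> \<le> (C * norm (W - \<i> * complex_of_real t)) * (C * norm (V - \<i> * complex_of_real t))"
        by (rule mult_mono[OF 1 2]) (use 1 in auto)
      finally have num: "norm (1 + complex_of_real t ^ 2) \<le> (C * norm (W - \<i> * complex_of_real t)) * (C * norm (V - \<i> * complex_of_real t))" .
      hence "norm ((1 + complex_of_real t ^ 2) / ((W - \<i> * complex_of_real t) * (V - \<i> * complex_of_real t))) \<le> C * C"
      proof -
        have "n / (a * b) \<le> C * C" if "n \<le> (C * a) * (C * b)" "a > 0" "b > 0" for n a b :: real
          using that by (simp add: pos_divide_le_eq ac_simps)
        moreover have "norm (W - \<i> * complex_of_real t) > 0" "norm (V - \<i> * complex_of_real t) > 0"
          using nz[of W t] nz[of V t] V inb[OF W] c by auto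
        ultimately show ?thesis unfolding norm_divide norm_mult
          using num by blast
      qed
      thus ?thesis unfolding D_def norm_mult norm_minus_cancel
        by (intro mult_mono) (use B B0 in auto)
    qed
    have quot: "(k W t - k V t) / (W - V) = D W t" if "W \<in> ball V c" "W \<noteq> V" for W t
    proof -
      have e: "(1 - \<i> * complex_of_real t * W) / (W - \<i> * complex_of_real t) - (1 - \<i> * complex_of_real t * V) / (V - \<i> * complex_of_real t)
        = (W - V) * (- ((1 + complex_of_real t ^ 2) / ((W - \<i> * complex_of_real t) * (V - \<i> * complex_of_real t))))"
        using nz[of W t] nz[of V t] V inb[OF that(1)] c
        by (simp add: divide_simps) (simp add: algebra_simps power2_eq_square)
      show ?thesis using that unfolding k_def D_def right_diff_distrib[symmetric] e by simp
    qed
    have "((\<lambda>W. (h W - h V) / (W - V)) \<longlongrightarrow> (\<integral>t. D V t \<partial>cauchy_measure)) (at V within ball V c)"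
      unfolding tendsto_at_iff_sequentially comp_def
    proof (intro allI impI)
      fix W :: "nat \<Rightarrow> complex" assume W: "\<forall>i. W i \<in> ball V c - {V}" and lim: "W \<longlonglongrightarrow> V"
      have "(h (W n) - h V) / (W n - V) = (\<integral>t. D (W n) t \<partial>cauchy_measure)" for n
      proof -
        have Wn: "W n \<in> ball V c" "W n \<noteq> V" "Re (W n) > 0" using W inb[of "W n"] c by auto
        have "(h (W n) - h V) / (W n - V) = (\<integral>t. (k (W n) t - k V t) / (W n - V) \<partial>cauchy_measure)"
          unfolding h_def using k_int[OF Wn(3)] k_int[OF V] by simp
        thus ?thesis using quot[OF Wn(1,2)] by simp
      qed
      moreover have "(\<lambda>n. \<integral>t. D (W n) t \<partial>cauchy_measure) \<longlonglongrightarrow> (\<integral>t. D V t \<partial>cauchy_measure)"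
      proof (rule integral_dominated_convergence[where w="\<lambda>_. B * (C * C)"])
        show "AE t in cauchy_measure. (\<lambda>n. D (W n) t) \<longlonglongrightarrow> D V t"
        proof (rule AE_I2)
          fix t show "(\<lambda>n. D (W n) t) \<longlonglongrightarrow> D V t"
            unfolding D_def using nz[OF V] by (intro tendsto_intros lim) auto
        qed
        show "AE t in cauchy_measure. norm (D (W n) t) \<le> B * (C * C)" for n
          using Dbound W by auto
        show "D V \<in> borel_measurable cauchy_measure" "D (W n) \<in> borel_measurable cauchy_measure" for n
          unfolding D_def by measurable
      qed simp
      ultimately show "(\<lambda>n. (h (W n) - h V) / (W n - V)) \<longlonglongrightarrow> (\<integral>t. D V t \<partial>cauchy_measure)" by simp
    qed
    hence "(h has_field_derivative (\<integral>t. D V t \<partial>cauchy_measure)) (at V within ball V c)"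
      by (simp add: has_field_derivative_iff)
    hence "(h has_field_derivative (\<integral>t. D V t \<partial>cauchy_measure)) (at V)"
      using c by (simp add: at_within_open[of V "ball V c"])
    thus "h field_differentiable at V within {V. Re V > 0}"
      using field_differentiable_at_within field_differentiable_def by blast
  qed
  thus ?thesis using Re_h that by blast
qed

section \<open>Mean value properties on the unit disc\<close>

text \<open>On the disc \<open>q\<close> has a primitive, whose real part differs from
  \<open>v\<close> by a constant. So \<open>v\<close> is the real part of a holomorphic function,
  and Cauchy's formula on the circle gives its value at the centre.\<close>

lemma harmonic_mean_value_circle:
  assumes q: "q holomorphic_on ball 0 1"
    and v: "\<And>z. z \<in> ball 0 1 \<Longrightarrow> (v has_derivative (\<lambda>h. Re (q z * h))) (at z)"
    and r: "0 < r" "r < 1"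
  shows "((\<lambda>t. v (of_real r * exp (2 * of_real pi * \<i> * of_real t))) has_integral v 0) {0..1}"
proof -
  obtain Q where Q: "\<And>z. z \<in> ball 0 1 \<Longrightarrow> (Q has_field_derivative q z) (at z within ball 0 1)"
    using holomorphic_convex_primitive'[OF convex_ball open_ball q] by blast
  have "\<exists>c. \<forall>z\<in>ball (0::complex) 1. v z - Re (Q z) = c"
  proof (rule has_derivative_zero_constant)
    fix z :: complex assume z: "z \<in> ball 0 1"
    have "(Q has_derivative (\<lambda>h. q z * h)) (at z within ball 0 1)"
      using Q[OF z] by (simp add: has_field_derivative_def)
    hence "((\<lambda>z. Re (Q z)) has_derivative (\<lambda>h. Re (q z * h))) (at z within ball 0 1)"
      by (rule has_derivative_Re)
    from has_derivative_diff[OF has_derivative_at_withinI[OF v[OF z]] this]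
    show "((\<lambda>z. v z - Re (Q z)) has_derivative (\<lambda>h. 0)) (at z within ball 0 1)" by simp
  qed simp
  then obtain c where "\<And>z. z \<in> ball 0 1 \<Longrightarrow> v z - Re (Q z) = c" by blast
  hence c: "v z = Re (Q z + of_real c)" if "z \<in> ball 0 1" for z
    using that by (simp add: algebra_simps)
  define P where "P z = Q z + of_real c" for z
  have "Q holomorphic_on ball 0 1"
    unfolding holomorphic_on_def field_differentiable_def using Q by blast
  hence "P holomorphic_on ball 0 1"
    unfolding P_def by (intro holomorphic_intros)
  hence "P holomorphic_on cball 0 r"
    by (rule holomorphic_on_subset) (use r in auto)
  hence "((\<lambda>u. P u / (u - 0)) has_contour_integral (2 * of_real pi * \<i> * P 0)) (circlepath 0 r)"
    by (rule Cauchy_integral_circlepath_simple) (use r in auto)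
  hence "((\<lambda>t. P (circlepath 0 r t) / circlepath 0 r t * (2 * pi * \<i> * r * exp (2 * of_real pi * \<i> * t)))
     has_integral (2 * of_real pi * \<i> * P 0)) {0..1}"
    unfolding has_contour_integral_def
    by (rule has_integral_eq[rotated]) (simp add: vector_derivative_circlepath01)
  hence "((\<lambda>t. (2 * of_real pi * \<i>) * P (of_real r * exp (2 * of_real pi * \<i> * of_real t)))
     has_integral (2 * of_real pi * \<i> * P 0)) {0..1}"
    by (rule has_integral_eq[rotated]) (use r in \<open>simp add: circlepath\<close>)
  from has_integral_mult_right[OF this, of "1 / (2 * of_real pi * \<i>)"]
  have "((\<lambda>t. P (of_real r * exp (2 * of_real pi * \<i> * of_real t))) has_integral P 0) {0..1}" by simp
  from has_integral_linear[OF this bounded_linear_Re]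
  have "((\<lambda>t. Re (P (of_real r * exp (2 * of_real pi * \<i> * of_real t)))) has_integral Re (P 0)) {0..1}"
    by (simp add: comp_def)
  moreover have "v 0 = Re (P 0)" by (simp add: c P_def)
  ultimately show ?thesis
    using r by (elim has_integral_eq[rotated] ssubst) (auto simp: c P_def norm_mult)
qed

text \<open>Dominated convergence as the radius tends to 1. Radial limits are required only almost
  everywhere, which leaves room for the boundary points at which the conformal map has no
  limit.\<close>

lemma harmonic_mean_value_boundary:
  fixes v :: "complex \<Rightarrow> real"
  assumes q: "q holomorphic_on ball 0 1"
    and v: "\<And>z. z \<in> ball 0 1 \<Longrightarrow> (v has_derivative (\<lambda>h. Re (q z * h))) (at z)"
    and B: "\<And>z. z \<in> ball 0 1 \<Longrightarrow> \<bar>v z\<bar> \<le> B"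
    and w: "w \<in> borel_measurable borel"
    and lim: "AE t in restrict_space lborel {0..1}.
       ((\<lambda>r. v (of_real r * exp (2 * of_real pi * \<i> * of_real t))) \<longlongrightarrow> w t) (at_left 1)"
  shows "v 0 = (\<integral>t. w t \<partial>restrict_space lborel {0..1})"
proof -
  let ?U = "restrict_space lborel {0..1::real}"
  let ?e = "\<lambda>t. exp (2 * of_real pi * \<i> * complex_of_real t)"
  define r where "r n = 1 - 1 / (real n + 2)" for n
  have r: "0 < r n" "r n < 1" "\<bar>r n\<bar> < 1" for n by (auto simp: r_def field_simps)
  have rlim: "r \<longlonglongrightarrow> 1" unfolding r_def by real_asymp
  have "filterlim r (at_left 1) sequentially"
    unfolding filterlim_at using rlim r by (simp add: eventually_sequentially less_imp_neq)
  note fr = this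
  have lim': "AE t in ?U. (\<lambda>n. v (of_real (r n) * ?e t)) \<longlonglongrightarrow> w t"
    using lim by eventually_elim (rule filterlim_compose[OF _ fr])
  have vc: "continuous_on (ball 0 1) v"
    using v has_derivative_continuous by (metis continuous_at_imp_continuous_on)
  have cont: "continuous_on A (\<lambda>t. v (of_real (r n) * ?e t))" for n A
    by (rule continuous_on_compose2[OF vc]) (use r in \<open>auto intro!: continuous_intros simp: norm_mult\<close>)
  have meas [measurable]: "(\<lambda>t. v (of_real (r n) * ?e t)) \<in> borel_measurable borel" for n
    by (rule borel_measurable_continuous_onI[OF cont])
  have bnd: "\<bar>v (of_real (r n) * ?e t)\<bar> \<le> B" for n t
    using r by (intro B) (simp add: norm_mult)
  have "(\<integral>t. v (of_real (r n) * ?e t) \<partial>?U) = v 0" for n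
  proof -
    have "set_integrable lborel {0..1} (\<lambda>t. v (of_real (r n) * ?e t))"
      unfolding set_integrable_def by (rule borel_integrable_compact) (auto intro: cont)
    hence "(LINT t:{0..1}|lborel. v (of_real (r n) * ?e t)) = integral {0..1} (\<lambda>t. v (of_real (r n) * ?e t))"
      by (rule set_borel_integral_eq_integral)
    also have "\<dots> = v 0" by (rule integral_unique[OF harmonic_mean_value_circle[OF q v r(1,2)]])
    finally show ?thesis by (simp add: integral_restrict_space set_lebesgue_integral_def)
  qed
  moreover have "(\<lambda>n. \<integral>t. v (of_real (r n) * ?e t) \<partial>?U) \<longlonglongrightarrow> (\<integral>t. w t \<partial>?U)"
  proof (rule integral_dominated_convergence[where w="\<lambda>_. B"])
    show "integrable ?U (\<lambda>_. B)"
      by (auto intro!: finite_measure.integrable_const finite_measure_restrict_space finite_measureI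
          simp: emeasure_restrict_space space_restrict_space)
    show "AE x in ?U. norm (v (of_real (r n) * ?e x)) \<le> B" for n using bnd by simp
    show "w \<in> borel_measurable ?U" "(\<lambda>t. v (of_real (r n) * ?e t)) \<in> borel_measurable ?U" for n
      using w by (auto intro: measurable_restrict_space1)
  qed (rule lim')
  ultimately show ?thesis using LIMSEQ_unique by (simp add: LIMSEQ_const_iff)
qed

subsection \<open>The spiral map\<close>

definition right_halfplane :: "complex set" where
  "right_halfplane = {V. Re V > 0}"

text \<open>The origin is left out because, like infinity, it corresponds to an end of the
  strip.\<close>

definition closed_halfplane :: "complex set" where
  "closed_halfplane = {V. Re V \<ge> 0 \<and> V \<noteq> 0}"

text \<open>The shift by 3 lifts the strip |Im| \<le> pi/2 to heights between 1 and 5. Positive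
  heights keep the outer logarithm off its branch cut, with argument strictly between 0 and pi; a
  ratio of heights below \<open>exp (2 * pi)\<close> keeps the final exponential injective.\<close>

definition strip_map :: "complex \<Rightarrow> complex" where
  "strip_map V = Ln V + 3 * \<i>"

definition spiral :: "real \<Rightarrow> complex \<Rightarrow> complex" where
  "spiral s V = exp (of_real s * \<i> * Ln (strip_map V))"

lemma right_halfplane_subset: "right_halfplane \<subseteq> closed_halfplane"
  by (auto simp: right_halfplane_def closed_halfplane_def)

lemma right_halfplane_closed: "V \<in> right_halfplane \<Longrightarrow> V \<in> closed_halfplane"
  using right_halfplane_subset by blast

lemma open_right_halfplane: "open right_halfplane"
  unfolding right_halfplane_def by (rule open_halfspace_Re_gt)

lemma convex_right_halfplane: "convex right_halfplane"
  unfolding right_halfplane_def by (rule convex_halfspace_Re_gt)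

lemma closed_halfplane_not_nonpos: "V \<in> closed_halfplane \<Longrightarrow> V \<notin> \<real>\<^sub>\<le>\<^sub>0"
  by (auto simp: closed_halfplane_def complex_nonpos_Reals_iff complex_eq_iff)

lemma Im_Ln_closed_halfplane: "V \<in> closed_halfplane \<Longrightarrow> \<bar>Im (Ln V)\<bar> \<le> pi / 2"
  using Re_Ln_pos_le[of V] by (auto simp: closed_halfplane_def)

lemma Im_strip_map:
  assumes "V \<in> closed_halfplane"
  shows "1 < Im (strip_map V)" "Im (strip_map V) < 5"
  using Im_Ln_closed_halfplane[OF assms] pi_less_4 by (auto simp: strip_map_def)

lemma norm_strip_map_ge: "V \<in> closed_halfplane \<Longrightarrow> norm (strip_map V) \<ge> 1"
  using Im_strip_map(1)[of V] abs_Im_le_cmod[of "strip_map V"] by linarith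

lemma strip_map_nz: "V \<in> closed_halfplane \<Longrightarrow> strip_map V \<noteq> 0"
  using norm_strip_map_ge[of V] by auto

lemma strip_map_not_nonpos: "V \<in> closed_halfplane \<Longrightarrow> strip_map V \<notin> \<real>\<^sub>\<le>\<^sub>0"
  using Im_strip_map(1)[of V] by (auto simp: complex_nonpos_Reals_iff)

lemma exp_strip_map: "V \<in> closed_halfplane \<Longrightarrow> exp (strip_map V - 3 * \<i>) = V"
  by (simp add: strip_map_def closed_halfplane_def)

lemma Im_Ln_strip_map:
  assumes "V \<in> closed_halfplane"
  shows "0 < Im (Ln (strip_map V))" "Im (Ln (strip_map V)) < pi"
  using Im_Ln_pos_lt_imp[of "strip_map V"] Im_strip_map(1)[OF assms] by auto

lemma norm_spiral: "norm (spiral s V) = exp (- s * Im (Ln (strip_map V)))"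
  by (simp add: spiral_def)

lemma spiral_nz [simp]: "spiral s V \<noteq> 0"
  by (simp add: spiral_def)

lemma norm_spiral_bounds:
  assumes "\<bar>s\<bar> = 1" "V \<in> closed_halfplane"
  shows "exp (- pi) \<le> norm (spiral s V)" "norm (spiral s V) \<le> exp pi"
  using Im_Ln_strip_map[OF assms(2)] assms(1) by (auto simp: norm_spiral abs_if split: if_splits)

text \<open>Equal images mean that the outer logarithms differ by a real multiple 2 pi n, so the two
  points of the strip differ by the positive factor \<open>exp (s * (2 * n * pi))\<close>. For n
  \<noteq> 0 that factor or its inverse exceeds 5, while all heights lie between 1 and 5.\<close>

lemma inj_on_spiral:
  assumes s: "\<bar>s\<bar> = 1"
  shows "inj_on (spiral s) closed_halfplane"
proof (rule inj_onI)
  fix V W assume V: "V \<in> closed_halfplane" and W: "W \<in> closed_halfplane" and eq: "spiral s V = spiral s W"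
  have ss: "s * s = 1" using s by (auto simp: abs_if split: if_splits)
  obtain n :: int where "of_real s * \<i> * Ln (strip_map V) = of_real s * \<i> * Ln (strip_map W) + (of_int (2 * n) * pi) * \<i>"
    using eq unfolding spiral_def exp_eq by blast
  hence "of_real s * (of_real s * \<i> * Ln (strip_map V)) = of_real s * (of_real s * \<i> * Ln (strip_map W) + (of_int (2 * n) * pi) * \<i>)"
    by simp
  moreover have "of_real s * (of_real s * \<i> * z) = \<i> * z" for z
    using ss by (metis mult.assoc mult.left_neutral of_real_1 of_real_mult)
  ultimately have "\<i> * Ln (strip_map V) = \<i> * Ln (strip_map W) + of_real s * (of_int (2 * n) * pi) * \<i>"
    by (simp add: distrib_left)
  hence "Ln (strip_map V) = Ln (strip_map W) + of_real (s * (of_int (2 * n) * pi))"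
    by (simp add: complex_eq_iff)
  hence "exp (Ln (strip_map V)) = exp (Ln (strip_map W) + of_real (s * (of_int (2 * n) * pi)))"
    by simp
  also have "\<dots> = exp (Ln (strip_map W)) * of_real (exp (s * (of_int (2 * n) * pi)))"
    by (simp only: exp_add exp_of_real)
  finally have "exp (Ln (strip_map V)) = exp (Ln (strip_map W)) * of_real (exp (s * (of_int (2 * n) * pi)))" .
  hence e: "strip_map V = strip_map W * of_real (exp (s * (of_int (2 * n) * pi)))"
    using V W strip_map_nz by simp
  define x where "x = s * (of_int (2 * n) * pi)"
  have im: "Im (strip_map V) = Im (strip_map W) * exp x" unfolding e x_def by simp
  have "n = 0"
  proof (rule ccontr)
    assume "n \<noteq> 0"
    hence "\<bar>real_of_int n\<bar> \<ge> 1" by linarith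
    hence "\<bar>x\<bar> \<ge> 6" using s pi_gt3 mult_mono[of 1 "\<bar>real_of_int n\<bar>" 6 "2 * pi"] by (simp add: x_def abs_mult algebra_simps)
    hence "x \<ge> 6 \<or> - x \<ge> 6" by linarith
    moreover have "exp y > 5" if "y \<ge> 6" for y :: real using exp_ge_add_one_self[of y] that by linarith
    ultimately have "exp x > 5 \<or> exp (- x) > 5" by blast
    moreover have "Im (strip_map W) = Im (strip_map V) * exp (- x)" using im by (simp add: exp_minus)
    moreover have "1 * 5 < Im (strip_map W) * exp x" if "exp x > 5"
      by (rule mult_strict_mono) (use that Im_strip_map[OF W] in auto)
    moreover have "1 * 5 < Im (strip_map V) * exp (- x)" if "exp (- x) > 5"
      by (rule mult_strict_mono) (use that Im_strip_map[OF V] in auto)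
    ultimately show False
      using im Im_strip_map(2)[OF V] Im_strip_map(2)[OF W] by linarith
  qed
  hence "strip_map V = strip_map W" using e by simp
  thus "V = W" using exp_strip_map[OF V] exp_strip_map[OF W] by metis
qed

lemma continuous_on_strip_map: "continuous_on closed_halfplane strip_map"
  unfolding strip_map_def by (intro continuous_intros) (auto dest: closed_halfplane_not_nonpos)

lemma continuous_on_spiral: "continuous_on closed_halfplane (spiral s)"
  unfolding spiral_def
  by (intro continuous_intros continuous_on_strip_map) (auto dest: strip_map_not_nonpos)

lemma has_field_derivative_spiral:
  assumes "V \<in> closed_halfplane"
  shows "(spiral s has_field_derivative (spiral s V * (of_real s * \<i> / (strip_map V * V)))) (at V)"
proof -
  have "V \<noteq> 0" using assms by (simp add: closed_halfplane_def)
  have "(strip_map has_field_derivative inverse V) (at V)"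
    unfolding strip_map_def[abs_def] using closed_halfplane_not_nonpos[OF assms]
    by (auto intro!: derivative_eq_intros)
  moreover have "(Ln has_field_derivative inverse (strip_map V)) (at (strip_map V))"
    using strip_map_not_nonpos[OF assms] by (rule has_field_derivative_Ln)
  ultimately have d: "((\<lambda>V. Ln (strip_map V)) has_field_derivative (inverse (strip_map V) * inverse V)) (at V)"
    by (rule DERIV_chain2[rotated])
  have "((\<lambda>V. exp (of_real s * \<i> * Ln (strip_map V))) has_field_derivative
     (exp (of_real s * \<i> * Ln (strip_map V)) * (of_real s * \<i> * (inverse (strip_map V) * inverse V)))) (at V)"
    by (rule DERIV_chain2[OF DERIV_exp DERIV_cmult[OF d]])
  thus ?thesis unfolding spiral_def[abs_def] by (simp add: field_simps)
qed

lemma holomorphic_on_spiral: "spiral s holomorphic_on right_halfplane"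
  unfolding holomorphic_on_def field_differentiable_def
  using has_field_derivative_spiral right_halfplane_closed has_field_derivative_at_within by blast

lemma inj_on_spiral_open: "\<bar>s\<bar> = 1 \<Longrightarrow> inj_on (spiral s) right_halfplane"
  using inj_on_spiral inj_on_subset right_halfplane_subset by blast

lemma open_spiral_image: "\<bar>s\<bar> = 1 \<Longrightarrow> open (spiral s ` right_halfplane)"
  using open_mapping_thm3[OF holomorphic_on_spiral open_right_halfplane inj_on_spiral_open] .

lemma connected_spiral_image: "connected (spiral s ` right_halfplane)"
  using connected_continuous_image[OF holomorphic_on_imp_continuous_on[OF holomorphic_on_spiral]]
    convex_connected[OF convex_right_halfplane] by blast

section \<open>Behaviour at the two ends of the strip\<close>

text \<open>A bounded displacement far out changes the strip coordinate by a factor tending to 1.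
  Since \<open>spiral\<close> sees that coordinate only through its logarithm, its value is
  multiplied by a factor tending to 1.\<close>

lemma spiral_asymptotic:
  assumes s: "\<bar>s\<bar> = 1" and V: "\<And>n. V n \<in> closed_halfplane"
    and inf: "filterlim (\<lambda>n. norm (strip_map (V n))) at_top sequentially"
    and W: "eventually (\<lambda>n. W n \<in> closed_halfplane \<and> norm (strip_map (W n) - strip_map (V n)) \<le> C) sequentially"
    and lim: "(\<lambda>n. spiral s (V n)) \<longlonglongrightarrow> \<zeta>"
  shows "(\<lambda>n. spiral s (W n)) \<longlonglongrightarrow> \<zeta>"
proof -
  define d where "d n = (strip_map (W n) - strip_map (V n)) / strip_map (V n)" for n
  have "(\<lambda>n. C / norm (strip_map (V n))) \<longlonglongrightarrow> 0"
    by (rule tendsto_divide_0[OF tendsto_const filterlim_at_top_imp_at_infinity[OF inf]])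
  hence "d \<longlonglongrightarrow> 0"
  proof (rule Lim_null_comparison[rotated])
    show "eventually (\<lambda>n. norm (d n) \<le> C / norm (strip_map (V n))) sequentially"
      using W by eventually_elim (auto simp: d_def norm_divide divide_right_mono)
  qed
  hence "(\<lambda>n. exp (of_real s * \<i> * Ln (1 + d n))) \<longlonglongrightarrow> exp (of_real s * \<i> * Ln (1 + 0))"
    by (intro tendsto_intros) auto
  hence "(\<lambda>n. spiral s (V n) * exp (of_real s * \<i> * Ln (1 + d n))) \<longlonglongrightarrow> \<zeta> * 1"
    by (intro tendsto_mult lim) simp
  moreover have "eventually (\<lambda>n. spiral s (V n) * exp (of_real s * \<i> * Ln (1 + d n)) = spiral s (W n)) sequentially"
    using W
  proof eventually_elim
    case (elim n)
    hence K: "W n \<in> closed_halfplane" by simp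
    define D where "D = Ln (strip_map (W n)) - Ln (strip_map (V n))"
    have "exp D = 1 + d n"
      using strip_map_nz[OF K] strip_map_nz[OF V] by (simp add: D_def d_def exp_diff diff_divide_distrib)
    \<comment> \<open>Both logarithms have imaginary part in (0, pi), so their difference stays
      within the principal branch.\<close>
    moreover have "Ln (exp D) = D"
      using Im_Ln_strip_map[OF K] Im_Ln_strip_map[OF V[of n]] by (intro Ln_exp) (auto simp: D_def)
    ultimately have "Ln (1 + d n) = D" by simp
    thus ?case unfolding spiral_def exp_add[symmetric] by (simp add: D_def right_diff_distrib)
  qed
  ultimately show ?thesis using Lim_transform_eventually by fastforce
qed

text \<open>The height of the strip is bounded, so at points of large modulus the sine of the
  argument is small. The limiting argument is therefore 0 or pi, and the modulus of the image is
  determined by the argument.\<close>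

lemma norm_spiral_limit_infinity:
  assumes s: "\<bar>s\<bar> = 1" and V: "\<And>n. V n \<in> closed_halfplane"
    and inf: "filterlim (\<lambda>n. norm (strip_map (V n))) at_top sequentially"
    and lim: "(\<lambda>n. spiral s (V n)) \<longlonglongrightarrow> \<zeta>"
  shows "norm \<zeta> = 1 \<or> norm \<zeta> = exp (- s * pi)"
proof -
  define a where "a n = Im (Ln (strip_map (V n)))" for n
  have ss: "s * s = 1" using s by (auto simp: abs_if split: if_splits)
  have a: "0 < a n" "a n < pi" for n using Im_Ln_strip_map[OF V[of n]] by (auto simp: a_def)
  have n: "(\<lambda>n. exp (- s * a n)) \<longlonglongrightarrow> norm \<zeta>"
    using tendsto_norm[OF lim] by (simp add: norm_spiral a_def)
  have "exp (- pi) \<le> norm \<zeta>"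
    by (rule tendsto_lowerbound[OF tendsto_norm[OF lim]])
      (auto intro!: always_eventually norm_spiral_bounds[OF s V])
  hence nz: "norm \<zeta> > 0" by (rule less_le_trans[rotated]) simp
  have "(\<lambda>n. - s * ln (exp (- s * a n))) \<longlonglongrightarrow> - s * ln (norm \<zeta>)"
    by (intro tendsto_intros n) (use nz in auto)
  moreover have "- s * ln (exp (- s * a n)) = a n" for n
    using ss by (simp add: mult.assoc[symmetric])
  ultimately have al: "a \<longlonglongrightarrow> - s * ln (norm \<zeta>)" (is "a \<longlonglongrightarrow> ?l") by (simp only:)
  have "(\<lambda>n. 5 / norm (strip_map (V n))) \<longlonglongrightarrow> 0"
    by (rule tendsto_divide_0[OF tendsto_const filterlim_at_top_imp_at_infinity[OF inf]])
  hence "(\<lambda>n. sin (a n)) \<longlonglongrightarrow> 0"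
  proof (rule Lim_null_comparison[rotated], intro always_eventually allI)
    fix n
    let ?z = "strip_map (V n)"
    have "Im ?z = exp (Re (Ln ?z)) * sin (a n)"
      unfolding a_def Im_exp[symmetric] using strip_map_nz[OF V] by simp
    also have "exp (Re (Ln ?z)) = norm ?z" using strip_map_nz[OF V] by simp
    finally have "Im ?z = norm ?z * sin (a n)" .
    hence "sin (a n) = Im ?z / norm ?z" using strip_map_nz[OF V] by simp
    thus "norm (sin (a n)) \<le> 5 / norm ?z"
      using Im_strip_map[OF V[of n]] by (simp add: divide_right_mono)
  qed
  hence sl: "sin ?l = 0" using tendsto_sin[OF al] LIMSEQ_unique by blast
  have l0: "0 \<le> ?l" by (rule LIMSEQ_le_const[OF al]) (use a less_imp_le in blast)
  have l1: "?l \<le> pi" by (rule LIMSEQ_le_const2[OF al]) (use a less_imp_le in blast)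
  have "?l = 0 \<or> ?l = pi"
    using sl l0 l1 sin_gt_zero[of ?l] by force
  moreover have "norm \<zeta> = exp (- s * ?l)" using ss nz by (simp add: mult.assoc[symmetric])
  ultimately show ?thesis by (metis exp_zero mult_zero_right)
qed

text \<open>Compactness in the strip: if the moduli do not tend to infinity, a subsequence stays in
  a bounded part of the strip and has a limit there, which the exponential carries back to a nonzero
  point of the half-plane.\<close>

lemma spiral_limit_cases:
  assumes s: "\<bar>s\<bar> = 1" and V: "\<And>n. V n \<in> closed_halfplane"
    and lim: "(\<lambda>n. spiral s (V n)) \<longlonglongrightarrow> \<zeta>"
  obtains (infinity) "filterlim (\<lambda>n. norm (strip_map (V n))) at_top sequentially"
  | (finite) r W where "strict_mono (r :: nat \<Rightarrow> nat)" "W \<in> closed_halfplane" "(\<lambda>n. V (r n)) \<longlonglongrightarrow> W" "\<zeta> = spiral s W"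
proof (cases "filterlim (\<lambda>n. norm (strip_map (V n))) at_top sequentially")
  case False
  then obtain M where M: "\<not> eventually (\<lambda>n. M \<le> norm (strip_map (V n))) sequentially"
    unfolding filterlim_at_top by blast
  hence "\<exists>n\<ge>k. norm (strip_map (V n)) \<le> M" for k
    unfolding eventually_sequentially by (meson less_imp_le not_le)
  hence "infinite {n. norm (strip_map (V n)) \<le> M}"
    unfolding infinite_nat_iff_unbounded_le by blast
  then obtain r0 where r0: "strict_mono (r0 :: nat \<Rightarrow> nat)" "\<And>n. r0 n \<in> {n. norm (strip_map (V n)) \<le> M}"
    using infinite_enumerate by blast
  have "bounded (range (\<lambda>n. strip_map (V (r0 n))))"
    using r0(2) by (auto simp: bounded_iff)
  then obtain l r1 where r1: "strict_mono (r1 :: nat \<Rightarrow> nat)" "((\<lambda>n. strip_map (V (r0 n))) \<circ> r1) \<longlonglongrightarrow> l"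
    using bounded_imp_convergent_subsequence by metis
  define r where "r = r0 \<circ> r1"
  have r: "strict_mono r" unfolding r_def by (rule strict_mono_o[OF r0(1) r1(1)])
  have "(\<lambda>n. exp (strip_map (V (r n)) - 3 * \<i>)) \<longlonglongrightarrow> exp (l - 3 * \<i>)"
    using r1(2) by (intro tendsto_intros) (simp add: r_def comp_def)
  hence W: "(\<lambda>n. V (r n)) \<longlonglongrightarrow> exp (l - 3 * \<i>)" (is "_ \<longlonglongrightarrow> ?W")
    by (simp add: exp_strip_map[OF V])
  have "Re ?W \<ge> 0"
    by (rule LIMSEQ_le_const[OF tendsto_Re[OF W]]) (use V in \<open>auto simp: closed_halfplane_def\<close>)
  hence WK: "?W \<in> closed_halfplane" unfolding closed_halfplane_def by simp
  have "(\<lambda>n. spiral s (V (r n))) \<longlonglongrightarrow> spiral s ?W"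
    by (rule continuous_on_tendsto_compose[OF continuous_on_spiral W WK]) (simp add: V)
  moreover have "(\<lambda>n. spiral s (V (r n))) \<longlonglongrightarrow> \<zeta>"
    using LIMSEQ_subseq_LIMSEQ[OF lim r] by (simp add: comp_def)
  ultimately have "\<zeta> = spiral s ?W" using LIMSEQ_unique by blast
  with finite r WK W show ?thesis by blast
qed (rule infinity)

section \<open>The frontier of the image\<close>

lemma frontier_spiral_disjoint:
  assumes "\<bar>s\<bar> = 1" "V \<in> right_halfplane" shows "spiral s V \<notin> frontier (spiral s ` right_halfplane)"
  using open_spiral_image[OF assms(1)] assms(2) by (auto simp: frontier_def interior_open)

text \<open>The three pieces are the images of the edges of the strip and the limit circles of its
  two ends. An upper bound of this kind is what the covering by Lipschitz curves requires.\<close>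

lemma frontier_spiral_subset:
  assumes s: "\<bar>s\<bar> = 1"
  shows "frontier (spiral s ` right_halfplane) \<subseteq>
     spiral s ` (closed_halfplane - right_halfplane) \<union> sphere 0 1 \<union> sphere 0 (exp (- s * pi))"
proof
  fix \<zeta> assume z: "\<zeta> \<in> frontier (spiral s ` right_halfplane)"
  hence "\<zeta> \<in> closure (spiral s ` right_halfplane)" by (simp add: frontier_def)
  then obtain x where x: "\<And>n. x n \<in> spiral s ` right_halfplane" "x \<longlonglongrightarrow> \<zeta>"
    unfolding closure_sequential by blast
  have "\<forall>n. \<exists>v. v \<in> right_halfplane \<and> x n = spiral s v" using x(1) by blast
  then obtain V where V: "\<And>n. V n \<in> right_halfplane" "\<And>n. x n = spiral s (V n)" by metis
  have lim: "(\<lambda>n. spiral s (V n)) \<longlonglongrightarrow> \<zeta>" using x(2) unfolding V(2)[symmetric] .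
  have K: "V n \<in> closed_halfplane" for n using V right_halfplane_closed by blast
  show "\<zeta> \<in> spiral s ` (closed_halfplane - right_halfplane) \<union> sphere 0 1 \<union> sphere 0 (exp (- s * pi))"
  proof (cases rule: spiral_limit_cases[OF s K lim])
    case 1
    thus ?thesis using norm_spiral_limit_infinity[OF s K _ lim] by auto
  next
    case (2 r W)
    thus ?thesis using z frontier_spiral_disjoint[OF s, of W] by blast
  qed
qed

text \<open>Injectivity up to the edge keeps the point out of the open image, and translation to the
  right approaches it from inside.\<close>

lemma spiral_boundary_in_frontier:
  assumes s: "\<bar>s\<bar> = 1" and V: "V \<in> closed_halfplane" "V \<notin> right_halfplane"
  shows "spiral s V \<in> frontier (spiral s ` right_halfplane)"
proof -
  have "spiral s V \<notin> spiral s ` right_halfplane"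
    using inj_on_spiral[OF s] V right_halfplane_subset by (auto simp: inj_on_def)
  moreover have "spiral s V \<in> closure (spiral s ` right_halfplane)"
    unfolding closure_sequential
  proof (intro exI conjI allI)
    have in': "V + of_real (inverse (real (Suc n))) \<in> right_halfplane" for n
      using V by (auto simp: right_halfplane_def closed_halfplane_def intro!: add_nonneg_pos)
    show "spiral s (V + of_real (inverse (real (Suc n)))) \<in> spiral s ` right_halfplane" for n
      using in' by blast
    have "(\<lambda>n. V + of_real (inverse (real (Suc n)))) \<longlonglongrightarrow> V + of_real 0"
      by (intro tendsto_intros LIMSEQ_inverse_real_of_nat)
    thus "(\<lambda>n. spiral s (V + of_real (inverse (real (Suc n))))) \<longlonglongrightarrow> spiral s V"
      by (intro continuous_on_tendsto_compose[OF continuous_on_spiral _ V(1)])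
         (use in' right_halfplane_closed in auto)
  qed
  ultimately show ?thesis using open_spiral_image[OF s] by (simp add: frontier_def interior_open)
qed

lemma norm_spiral_image:
  assumes s: "\<bar>s\<bar> = 1" and V: "V \<in> closed_halfplane"
  shows "norm (spiral s V) \<noteq> 1" "s = 1 \<Longrightarrow> norm (spiral s V) < 1" "s = -1 \<Longrightarrow> norm (spiral s V) > 1"
  using Im_Ln_strip_map[OF V] s by (auto simp: norm_spiral)

text \<open>Along the centre line of the strip the argument of the image runs through every angle
  infinitely often, while its modulus tends to 1. It suffices to pick out the points whose image has
  the angle of \<zeta>.\<close>

lemma unit_circle_subset_frontier:
  assumes s: "\<bar>s\<bar> = 1"
  shows "sphere 0 1 \<subseteq> frontier (spiral s ` right_halfplane)"
proof
  fix \<zeta> :: complex assume "\<zeta> \<in> sphere 0 1"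
  hence n1: "norm \<zeta> = 1" by simp
  have ss: "s * s = 1" using s by (auto simp: abs_if split: if_splits)
  obtain \<alpha> where \<alpha>: "\<zeta> = exp (\<i> * of_real \<alpha>)" "\<bar>\<alpha>\<bar> \<le> pi"
  proof -
    have "\<zeta> \<noteq> 0" using n1 by auto
    thus ?thesis using that[of "Arg \<zeta>"] Arg_eq[of \<zeta>] n1 Arg_bounded[of \<zeta>] by auto
  qed
  \<comment> \<open>The moduli in the strip for which \<open>s * ln (m n)\<close> equals \<alpha> up
    to a multiple of 2 pi, because s * s = 1. The summand 2 makes \<open>m n\<close> exceed 3, so
    that the centre line, at height 3, has a point of this modulus.\<close>
  define m where "m n = exp (s * \<alpha> + 2 * pi * (real n + 2))" for n
  have mlow: "m n > 3" for n
  proof -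
    have "\<bar>s * \<alpha>\<bar> \<le> pi" using s \<alpha> by (simp add: abs_mult)
    hence "s * \<alpha> + 2 * pi * (real n + 2) \<ge> 3" using pi_gt3 by (auto simp: algebra_simps) (smt (verit) mult_nonneg_nonneg of_nat_0_le_iff)
    thus ?thesis unfolding m_def using exp_ge_add_one_self[of "s * \<alpha> + 2 * pi * (real n + 2)"] by linarith
  qed
  have m3: "(m n)\<^sup>2 \<ge> 9" for n using power_mono[of 3 "m n" 2] mlow[of n] by simp
  \<comment> \<open>The point of the centre line with modulus \<open>m n\<close> has real part
    \<open>sqrt ((m n)\<^sup>2 - 9)\<close>; its preimage is a positive real.\<close>
  define V where "V n = complex_of_real (exp (sqrt ((m n)\<^sup>2 - 9)))" for n
  have V: "V n \<in> right_halfplane" for n by (simp add: V_def right_halfplane_def)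
  have K: "V n \<in> closed_halfplane" for n using V right_halfplane_closed by blast
  have st: "strip_map (V n) = of_real (sqrt ((m n)\<^sup>2 - 9)) + 3 * \<i>" for n
    unfolding V_def strip_map_def by (simp add: Ln_of_real)
  have nst: "norm (strip_map (V n)) = m n" for n
    unfolding st cmod_def using m3[of n] mlow[of n] by simp
  have minf: "filterlim m at_top sequentially" unfolding m_def
    by (rule filterlim_compose[OF exp_at_top], rule filterlim_tendsto_add_at_top[OF tendsto_const],
        rule filterlim_tendsto_pos_mult_at_top[OF tendsto_const]) (simp, real_asymp)
  define a where "a n = Im (Ln (strip_map (V n)))" for n
  have a_lim: "a \<longlonglongrightarrow> 0"
  proof -
    have "(\<lambda>n. 3 / m n) \<longlonglongrightarrow> 0"
      by (rule tendsto_divide_0[OF tendsto_const filterlim_at_top_imp_at_infinity[OF minf]])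
    note lim0 = this
    have m31: "- 1 \<le> 3 / m n" "3 / m n \<le> 1" for n
      using mlow[of n] order_trans[of "-1" 0 "3 / m n"] by auto
    have "(\<lambda>n. arcsin (3 / m n)) \<longlonglongrightarrow> arcsin 0"
      by (rule continuous_on_tendsto_compose[OF continuous_on_arcsin' lim0])
        (use m31 in auto)
    moreover have "arcsin (3 / m n) = a n" for n
    proof -
      have Rp: "Re (strip_map (V n)) \<ge> 0" by (simp add: st m3)
      have "\<bar>a n\<bar> \<le> pi / 2" unfolding a_def using Rp strip_map_nz[OF K[of n]] Re_Ln_pos_le[of "strip_map (V n)"] by blast
      moreover have "sin (a n) = 3 / m n"
      proof -
        have "strip_map (V n) = exp (Ln (strip_map (V n)))" using strip_map_nz[OF K[of n]] by simp
        hence "Im (strip_map (V n)) = exp (Re (Ln (strip_map (V n)))) * sin (a n)"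
          unfolding a_def by (metis Im_exp)
        also have "exp (Re (Ln (strip_map (V n)))) = m n"
          using strip_map_nz[OF K[of n]] by (simp add: nst) (use mlow[of n] in simp)
        finally have "3 = m n * sin (a n)" by (simp add: st)
        thus ?thesis using mlow[of n] by (simp add: field_simps)
      qed
      ultimately show ?thesis using arcsin_sin[of "a n"] by (auto simp: abs_le_iff)
    qed
    ultimately show ?thesis by simp
  qed
  have sp: "spiral s (V n) = exp (- of_real (s * a n)) * \<zeta>" for n
  proof -
    have "Re (Ln (strip_map (V n))) = ln (m n)" using strip_map_nz[OF K[of n]] by (simp add: nst)
    hence "Ln (strip_map (V n)) = of_real (s * \<alpha> + 2 * pi * (real n + 2)) + \<i> * of_real (a n)"
      by (simp add: complex_eq_iff m_def a_def)
    hence "of_real s * \<i> * Ln (strip_map (V n)) = of_real (s * s) * (\<i> * of_real \<alpha>) + of_real s * \<i> * (2 * pi * (real n + 2)) - of_real (s * a n)"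
      by (simp add: algebra_simps)
    also have "\<dots> = - of_real (s * a n) + \<i> * of_real \<alpha> + \<i> * (of_real s * (2 * pi * (real n + 2)))"
      unfolding ss by simp
    finally have "spiral s (V n) = exp (- of_real (s * a n)) * \<zeta> * exp (\<i> * (of_real s * (2 * pi * (real n + 2))))"
      unfolding spiral_def \<alpha>(1) by (simp only: exp_add)
    moreover have "exp (\<i> * (of_real s * (2 * of_real pi * (of_nat n + 2)))) = 1"
    proof -
      have "s = 1 \<or> s = -1" using s by linarith
      define k where "k = (if s = 1 then int n + 2 else - (int n + 2))"
      have "\<i> * (of_real s * (2 * of_real pi * (of_nat n + 2))) = (2 * of_int k * of_real pi) * \<i>"
        using \<open>s = 1 \<or> s = -1\<close> by (auto simp: k_def algebra_simps)
      moreover have "exp ((2 * of_int k * of_real pi) * \<i>) = (1::complex)"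
        unfolding exp_eq_1 by (auto intro: exI[of _ k])
      ultimately show ?thesis by (simp only:)
    qed
    ultimately show ?thesis by simp
  qed
  have "(\<lambda>n. spiral s (V n)) \<longlonglongrightarrow> exp (- of_real (s * 0)) * \<zeta>"
    unfolding sp by (intro tendsto_intros a_lim)
  hence "(\<lambda>n. spiral s (V n)) \<longlonglongrightarrow> \<zeta>" by simp
  hence "\<zeta> \<in> closure (spiral s ` right_halfplane)"
    unfolding closure_sequential using V by (intro exI[of _ "\<lambda>n. spiral s (V n)"]) auto
  moreover have "\<zeta> \<notin> spiral s ` right_halfplane"
    using norm_spiral_image(1)[OF s] n1 right_halfplane_closed by blast
  ultimately show "\<zeta> \<in> frontier (spiral s ` right_halfplane)"
    using open_spiral_image[OF s] by (simp add: frontier_def interior_open)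
qed

text \<open>The points \<i> (Im V + Re V t) are where \<open>poisson\<close> samples its boundary
  data, so this is the geometric content of regularity. If V approaches a nonzero point of the
  imaginary axis, so do the samples. Otherwise the strip coordinates of V tend to infinity; the
  samples then have modulus comparable to |V|, hence stay at bounded distance from V in the strip,
  and \<open>spiral_asymptotic\<close> applies.\<close>

lemma spiral_boundary_convergence:
  assumes s: "\<bar>s\<bar> = 1" and V: "\<And>n. V n \<in> right_halfplane"
    and lim: "(\<lambda>n. spiral s (V n)) \<longlonglongrightarrow> \<zeta>"
    and z: "\<zeta> \<in> frontier (spiral s ` right_halfplane)"
  obtains r N where "strict_mono (r :: nat \<Rightarrow> nat)" "finite (N :: real set)"
    "\<And>t. t \<notin> N \<Longrightarrow> eventually (\<lambda>n. Im (V (r n)) + Re (V (r n)) * t \<noteq> 0) sequentially"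
    "\<And>t. t \<notin> N \<Longrightarrow> (\<lambda>n. spiral s (\<i> * of_real (Im (V (r n)) + Re (V (r n)) * t))) \<longlonglongrightarrow> \<zeta>"
proof -
  have K: "V n \<in> closed_halfplane" for n using V right_halfplane_closed by blast
  have K': "\<i> * of_real x \<in> closed_halfplane \<longleftrightarrow> x \<noteq> 0" for x by (auto simp: closed_halfplane_def)
  show ?thesis
  proof (cases rule: spiral_limit_cases[OF s K lim])
    case (2 r W)
    hence "W \<notin> right_halfplane" using frontier_spiral_disjoint[OF s, of W] z by blast
    with 2 have W: "Re W = 0" "Im W \<noteq> 0" by (auto simp: closed_halfplane_def right_halfplane_def complex_eq_iff)
    have l: "(\<lambda>n. Im (V (r n)) + Re (V (r n)) * t) \<longlonglongrightarrow> Im W + Re W * t" for t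
      using 2 by (intro tendsto_intros)
    hence ne: "eventually (\<lambda>n. Im (V (r n)) + Re (V (r n)) * t \<noteq> 0) sequentially" for t
      using W by (intro tendsto_imp_eventually_ne) auto
    have "(\<lambda>n. \<i> * complex_of_real (Im (V (r n)) + Re (V (r n)) * t)) \<longlonglongrightarrow> \<i> * of_real (Im W + Re W * t)" for t
      by (intro tendsto_intros l)
    moreover have "\<i> * of_real (Im W + Re W * t) = W" for t using W by (simp add: complex_eq_iff)
    ultimately have l': "(\<lambda>n. \<i> * complex_of_real (Im (V (r n)) + Re (V (r n)) * t)) \<longlonglongrightarrow> W" for t by (simp only:)
    have "(\<lambda>n. spiral s (\<i> * of_real (Im (V (r n)) + Re (V (r n)) * t))) \<longlonglongrightarrow> spiral s W" for t
      by (rule continuous_on_tendsto_compose[OF continuous_on_spiral l' 2(2)])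
         (use ne[of t] in eventually_elim, simp add: K' del: of_real_add of_real_mult)
    thus ?thesis using that[of r "{}"] 2 ne by auto
  next
    case 1
    \<comment> \<open>Once the scale |V n| is divided out, only the direction remains. It converges
      along a subsequence, and every sample is |V n| times a convergent factor.\<close>
    define e where "e n = V n / of_real (norm (V n))" for n
    have Vnz: "V n \<noteq> 0" for n using K[of n] by (simp add: closed_halfplane_def)
    have "norm (e n) = 1" for n using Vnz by (simp add: e_def norm_divide)
    hence "bounded (range e)" by (auto simp: bounded_iff)
    then obtain l r where r: "strict_mono (r :: nat \<Rightarrow> nat)" "(e \<circ> r) \<longlonglongrightarrow> l"
      using bounded_imp_convergent_subsequence by metis
    hence rl: "(\<lambda>n. e (r n)) \<longlonglongrightarrow> l" by (simp add: comp_def)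
    have "norm l = 1" using tendsto_norm[OF rl] \<open>\<And>n. norm (e n) = 1\<close> by (simp add: LIMSEQ_const_iff)
    \<comment> \<open>For these t the factor tends to 0 and its logarithm is unbounded. There is at
      most one such t, because \<open>l\<close> is a unit vector.\<close>
    define N where "N = {t. Im l + Re l * t = 0}"
    have "finite N"
    proof (cases "Re l = 0")
      case True
      hence "Im l \<noteq> 0" using \<open>norm l = 1\<close> by (auto simp: cmod_def)
      thus ?thesis using True by (simp add: N_def)
    next
      case False
      hence "N \<subseteq> {- Im l / Re l}" by (auto simp: N_def field_simps)
      thus ?thesis using finite_subset by blast
    qed
    define c where "c t n = Im (e (r n)) + Re (e (r n)) * t" for t n
    have Vc: "Im (V (r n)) + Re (V (r n)) * t = norm (V (r n)) * c t n" for t n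
      using Vnz[of "r n"] by (simp add: c_def e_def field_simps)
    have cl: "c t \<longlonglongrightarrow> Im l + Re l * t" for t unfolding c_def by (intro tendsto_intros rl)
    have cne: "eventually (\<lambda>n. c t n \<noteq> 0) sequentially" if "t \<notin> N" for t
      using cl[of t] that by (intro tendsto_imp_eventually_ne) (auto simp: N_def)
    have inf: "filterlim (\<lambda>n. norm (strip_map (V (r n)))) at_top sequentially"
      using filterlim_compose[OF 1 filterlim_subseq[OF r(1)]] .
    have lim': "(\<lambda>n. spiral s (V (r n))) \<longlonglongrightarrow> \<zeta>"
      using LIMSEQ_subseq_LIMSEQ[OF lim r(1)] by (simp add: comp_def)
    have "(\<lambda>n. spiral s (\<i> * of_real (Im (V (r n)) + Re (V (r n)) * t))) \<longlonglongrightarrow> \<zeta>" if t: "t \<notin> N" for t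
    proof (rule spiral_asymptotic[OF s _ inf _ lim'])
      have "(\<lambda>n. \<bar>ln \<bar>c t n\<bar>\<bar>) \<longlonglongrightarrow> \<bar>ln \<bar>Im l + Re l * t\<bar>\<bar>"
        using t by (intro tendsto_intros cl) (auto simp: N_def)
      hence "eventually (\<lambda>n. \<bar>ln \<bar>c t n\<bar>\<bar> < \<bar>ln \<bar>Im l + Re l * t\<bar>\<bar> + 1) sequentially"
        by (rule order_tendstoD) simp
      thus "eventually (\<lambda>n. \<i> * of_real (Im (V (r n)) + Re (V (r n)) * t) \<in> closed_halfplane \<and>
         norm (strip_map (\<i> * of_real (Im (V (r n)) + Re (V (r n)) * t)) - strip_map (V (r n)))
          \<le> (\<bar>ln \<bar>Im l + Re l * t\<bar>\<bar> + 1) + pi) sequentially"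
        using cne[OF t]
      proof eventually_elim
        case (elim n)
        let ?B = "\<i> * complex_of_real (Im (V (r n)) + Re (V (r n)) * t)"
        let ?d = "strip_map ?B - strip_map (V (r n))"
        have B: "?B \<in> closed_halfplane" unfolding K' Vc using elim Vnz by simp
        hence Bnz: "?B \<noteq> 0" by (simp add: closed_halfplane_def)
        have nB: "norm ?B = norm (V (r n)) * \<bar>c t n\<bar>" unfolding Vc by (simp add: norm_mult)
        have "Re (Ln ?B) = ln (norm (V (r n)) * \<bar>c t n\<bar>)" unfolding nB[symmetric] by (rule Re_Ln[OF Bnz])
        also have "\<dots> = ln (norm (V (r n))) + ln \<bar>c t n\<bar>"
          using Vnz elim by (intro ln_mult_pos) auto
        finally have "Re ?d = ln \<bar>c t n\<bar>" using Vnz by (simp add: strip_map_def)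
        moreover have "\<bar>Im ?d\<bar> \<le> pi"
          using Im_Ln_closed_halfplane[OF B] Im_Ln_closed_halfplane[OF K[of "r n"]] by (simp add: strip_map_def)
        ultimately have "norm ?d \<le> (\<bar>ln \<bar>Im l + Re l * t\<bar>\<bar> + 1) + pi"
          using cmod_le[of ?d] elim by linarith
        with B show ?case by blast
      qed
    qed (rule K)
    moreover have "eventually (\<lambda>n. Im (V (r n)) + Re (V (r n)) * t \<noteq> 0) sequentially" if "t \<notin> N" for t
      using cne[OF that] unfolding Vc by eventually_elim (use Vnz in auto)
    ultimately show ?thesis using that r(1) \<open>finite N\<close> by blast
  qed
qed

subsection \<open>The Dirichlet problem in spiral domains\<close>

lemma LIMSEQ_of_subsequences:
  fixes X :: "nat \<Rightarrow> 'a::metric_space"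
  assumes sub: "\<And>r. strict_mono (r :: nat \<Rightarrow> nat) \<Longrightarrow> \<exists>r'. strict_mono (r' :: nat \<Rightarrow> nat) \<and> (\<lambda>n. X (r (r' n))) \<longlonglongrightarrow> L"
  shows "X \<longlonglongrightarrow> L"
proof (rule ccontr)
  assume "\<not> X \<longlonglongrightarrow> L"
  then obtain e where e: "e > 0" "\<not> eventually (\<lambda>n. dist (X n) L < e) sequentially"
    unfolding tendsto_iff by blast
  hence "\<exists>n\<ge>k. dist (X n) L \<ge> e" for k
    unfolding eventually_sequentially by (meson not_le)
  hence "infinite {n. dist (X n) L \<ge> e}"
    unfolding infinite_nat_iff_unbounded_le by blast
  then obtain r where r: "strict_mono (r :: nat \<Rightarrow> nat)" "\<And>n. r n \<in> {n. dist (X n) L \<ge> e}"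
    using infinite_enumerate by blast
  obtain r' where r': "(\<lambda>n. X (r (r' n))) \<longlonglongrightarrow> L" using sub[OF r(1)] by blast
  have "eventually (\<lambda>n. dist (X (r (r' n))) L < e) sequentially" using tendstoD[OF r' e(1)] .
  moreover have "\<not> dist (X (r n)) L < e" for n using r(2)[of n] by simp
  ultimately show False by simp
qed

lemma harmonic_on_cong:
  assumes S: "open S" and u: "harmonic_on S u" and eq: "\<And>x. x \<in> S \<Longrightarrow> u x = v x"
  shows "harmonic_on S v"
proof -
  have "GDERIV v x :> D" if "x \<in> S" "GDERIV u x :> D" for x D
    using that(2) unfolding gderiv_def
    by (rule has_derivative_transform_within_open[OF _ S that(1)]) (rule eq)
  thus ?thesis using u unfolding harmonic_on_def by meson
qed

lemma harmonic_on_continuous: "harmonic_on S u \<Longrightarrow> x \<in> S \<Longrightarrow> isCont u x"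
  unfolding harmonic_on_def gderiv_def using has_derivative_continuous by blast

definition spiral_domain :: "real \<Rightarrow> plane set" where
  "spiral_domain s = to_plane ` spiral s ` right_halfplane"

definition spiral_inv :: "real \<Rightarrow> complex \<Rightarrow> complex" where
  "spiral_inv s = inv_into right_halfplane (spiral s)"

lemma spiral_inv_spiral: "\<bar>s\<bar> = 1 \<Longrightarrow> V \<in> right_halfplane \<Longrightarrow> spiral_inv s (spiral s V) = V"
  unfolding spiral_inv_def by (rule inv_into_f_f[OF inj_on_spiral_open])

lemma spiral_inv_in: "z \<in> spiral s ` right_halfplane \<Longrightarrow> spiral_inv s z \<in> right_halfplane"
  unfolding spiral_inv_def by (rule inv_into_into)

lemma spiral_spiral_inv: "z \<in> spiral s ` right_halfplane \<Longrightarrow> spiral s (spiral_inv s z) = z"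
  unfolding spiral_inv_def by (rule f_inv_into_f)

lemma holomorphic_on_spiral_inv:
  assumes s: "\<bar>s\<bar> = 1" shows "spiral_inv s holomorphic_on spiral s ` right_halfplane"
proof -
  obtain g where g: "g holomorphic_on spiral s ` right_halfplane" "\<And>z. z \<in> right_halfplane \<Longrightarrow> g (spiral s z) = z"
    using holomorphic_has_inverse[OF holomorphic_on_spiral open_right_halfplane inj_on_spiral_open[OF s]] by metis
  show ?thesis
    by (rule holomorphic_transform[OF g(1)]) (auto simp: g(2) spiral_inv_spiral[OF s])
qed

lemma open_spiral_domain: "\<bar>s\<bar> = 1 \<Longrightarrow> open (spiral_domain s)"
  unfolding spiral_domain_def by (intro open_to_plane open_spiral_image)

lemma domain_spiral_domain: 
  assumes "\<bar>s\<bar> = 1" shows "domain (spiral_domain s)"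
proof -
  have "connected (spiral_domain s)" unfolding spiral_domain_def
    by (intro connected_continuous_image connected_spiral_image continuous_intros)
  moreover have "to_plane (spiral s 1) \<in> spiral_domain s" by (simp add: right_halfplane_def spiral_domain_def)
  ultimately show ?thesis using open_spiral_domain[OF assms]
    unfolding domain_def by blast
qed

lemma frontier_spiral_domain:
  "\<bar>s\<bar> = 1 \<Longrightarrow> frontier (spiral_domain s) = to_plane ` frontier (spiral s ` right_halfplane)"
  unfolding spiral_domain_def by (intro frontier_to_plane open_spiral_image)

lemma closure_open_frontier: "open S \<Longrightarrow> closure S = S \<union> frontier S"
  using closure_Un_frontier[of S] by simp

text \<open>Convergence of the samples is known only along subsequences, hence the subsequence
  criterion. Along them the integrand tends to the constant \<open>f \<zeta>\<close> off a finite
  set and is bounded by \<open>B\<close>, and the measure has mass 1.\<close>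

lemma poisson_boundary_limit:
  assumes s: "\<bar>s\<bar> = 1" and V: "\<And>n. V n \<in> right_halfplane"
    and lim: "(\<lambda>n. spiral s (V n)) \<longlonglongrightarrow> \<zeta>"
    and z: "\<zeta> \<in> frontier (spiral s ` right_halfplane)"
    and f: "continuous_on (frontier (spiral s ` right_halfplane)) f"
    and F: "F \<in> borel_measurable borel" "\<And>t. \<bar>F t\<bar> \<le> B"
    and Ff: "\<And>t. t \<noteq> 0 \<Longrightarrow> F t = f (spiral s (\<i> * of_real t))"
  shows "(\<lambda>n. poisson F (V n)) \<longlonglongrightarrow> f \<zeta>"
proof (rule LIMSEQ_of_subsequences)
  fix r0 :: "nat \<Rightarrow> nat" assume r0: "strict_mono r0"
  interpret prob_space cauchy_measure by (rule prob_space_cauchy)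
  have [measurable]: "F \<in> borel_measurable borel" by fact
  have lim0: "(\<lambda>n. spiral s (V (r0 n))) \<longlonglongrightarrow> \<zeta>"
    using LIMSEQ_subseq_LIMSEQ[OF lim r0] by (simp add: comp_def)
  obtain r N where r: "strict_mono (r :: nat \<Rightarrow> nat)" and N: "finite (N :: real set)"
    and ne: "\<And>t. t \<notin> N \<Longrightarrow> eventually (\<lambda>n. Im (V (r0 (r n))) + Re (V (r0 (r n))) * t \<noteq> 0) sequentially"
    and l: "\<And>t. t \<notin> N \<Longrightarrow> (\<lambda>n. spiral s (\<i> * of_real (Im (V (r0 (r n))) + Re (V (r0 (r n))) * t))) \<longlonglongrightarrow> \<zeta>"
    by (rule spiral_boundary_convergence[OF s V lim0 z]) blast
  let ?b = "\<lambda>n t. Im (V (r0 (r n))) + Re (V (r0 (r n))) * t"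
  have "(\<lambda>n. poisson F (V (r0 (r n)))) \<longlonglongrightarrow> (\<integral>t. f \<zeta> \<partial>cauchy_measure)"
    unfolding poisson_def
  proof (rule integral_dominated_convergence[where w="\<lambda>_. B"])
    have "(\<lambda>n. F (?b n t)) \<longlonglongrightarrow> f \<zeta>" if t: "t \<notin> N" for t
    proof -
      have fr: "eventually (\<lambda>n. spiral s (\<i> * of_real (?b n t)) \<in> frontier (spiral s ` right_halfplane)) sequentially"
        using ne[OF t]
      proof eventually_elim
        case (elim n)
        show ?case
          by (rule spiral_boundary_in_frontier[OF s]) (use elim in \<open>auto simp: closed_halfplane_def right_halfplane_def complex_eq_iff\<close>)
      qed
      have "(\<lambda>n. f (spiral s (\<i> * of_real (?b n t)))) \<longlonglongrightarrow> f \<zeta>"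
        by (rule continuous_on_tendsto_compose[OF f l[OF t] z fr])
      moreover have "eventually (\<lambda>n. f (spiral s (\<i> * of_real (?b n t))) = F (?b n t)) sequentially"
        using ne[OF t] by eventually_elim (simp only: Ff not_False_eq_True)
      ultimately show ?thesis by (rule Lim_transform_eventually)
    qed
    moreover have "AE t in cauchy_measure. t \<notin> N"
      by (rule AE_cauchy_finite) (use N in simp)
    ultimately show "AE t in cauchy_measure. (\<lambda>n. F (?b n t)) \<longlonglongrightarrow> f \<zeta>"
      by (auto elim: eventually_mono)
  qed (use F in auto)
  thus "\<exists>r'. strict_mono (r' :: nat \<Rightarrow> nat) \<and> (\<lambda>n. poisson F (V (r0 (r' n)))) \<longlonglongrightarrow> f \<zeta>"
    using r prob_space by auto
qed

text \<open>The solution is the Poisson integral of the data pulled back to the imaginary axis. That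
  axis parametrises only the two bounding spirals, so the values of \<open>f\<close> on the limit
  circles never enter the integral; they are attained because the points of the spirals that are
  sampled converge to the same frontier point.\<close>

theorem wiener_regular_spiral_domain:
  assumes s: "\<bar>s\<bar> = 1" shows "wiener_regular (spiral_domain s)"
  unfolding wiener_regular_def
proof (intro allI impI, elim conjE)
  fix f :: "plane \<Rightarrow> real"
  let ?\<Omega> = "spiral_domain s" and ?S = "spiral s ` right_halfplane"
  assume fc: "continuous_on (frontier ?\<Omega>) f" and fb: "bounded (f ` frontier ?\<Omega>)"
  obtain B where B: "\<And>x. x \<in> frontier ?\<Omega> \<Longrightarrow> \<bar>f x\<bar> \<le> B" "B > 0"
    using fb unfolding bounded_pos by auto
  have oS: "open ?S" by (rule open_spiral_image[OF s])
  have o\<Omega>: "open ?\<Omega>" by (rule open_spiral_domain[OF s])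
  have fc': "continuous_on (frontier ?S) (\<lambda>z. f (to_plane z))"
    by (rule continuous_on_compose2[OF fc]) (auto intro!: continuous_intros simp: frontier_spiral_domain[OF s])
  have K: "\<i> * of_real t \<in> closed_halfplane" "\<i> * of_real t \<notin> right_halfplane" if "t \<noteq> 0" for t
    using that by (auto simp: closed_halfplane_def right_halfplane_def)
  have bd: "spiral s (\<i> * of_real t) \<in> frontier ?S" if "t \<noteq> 0" for t
    by (rule spiral_boundary_in_frontier[OF s K[OF that]])
  \<comment> \<open>The axis passes through an end of the strip at t = 0; the value 0 chosen there
    keeps \<open>F\<close> bounded and measurable.\<close>
  define F where "F t = indicator (- {0}) t *\<^sub>R f (to_plane (spiral s (\<i> * of_real t)))" for t
  have Ff: "F t = f (to_plane (spiral s (\<i> * of_real t)))" if "t \<noteq> 0" for t using that by (simp add: F_def)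
  have F_meas: "F \<in> borel_measurable borel" unfolding F_def
  proof (rule borel_measurable_continuous_on_indicator)
    have "continuous_on (- {0}) (\<lambda>t. spiral s (\<i> * complex_of_real t))"
      by (rule continuous_on_compose2[OF continuous_on_spiral]) (use K in \<open>auto intro!: continuous_intros\<close>)
    thus "continuous_on (- {0}) (\<lambda>t. f (to_plane (spiral s (\<i> * complex_of_real t))))"
      by (rule continuous_on_compose2[OF fc']) (use bd in auto)
  qed simp
  have F_bd: "\<bar>F t\<bar> \<le> B" for t
    using B bd[of t] by (cases "t = 0") (auto simp: F_def frontier_spiral_domain[OF s])
  obtain h where h: "h holomorphic_on right_halfplane" "\<And>V. V \<in> right_halfplane \<Longrightarrow> poisson F V = Re (h V)"
    using poisson_eq_Re_holomorphic[OF F_meas F_bd] unfolding right_halfplane_def by auto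
  define u where "u x = (if x \<in> ?\<Omega> then poisson F (spiral_inv s (of_plane x)) else f x)" for x
  have ofS: "of_plane x \<in> ?S" if "x \<in> ?\<Omega>" for x using that unfolding spiral_domain_def to_plane_image_iff' .
  have uf: "u x = f x" if "x \<in> frontier ?\<Omega>" for x
    using that o\<Omega> by (auto simp: u_def frontier_def interior_open)
  have harm: "harmonic_on ?\<Omega> u"
  proof (rule harmonic_on_cong[OF o\<Omega>])
    have "(\<lambda>z. h (spiral_inv s z)) holomorphic_on ?S"
      using holomorphic_on_compose_gen[OF holomorphic_on_spiral_inv[OF s] h(1)] spiral_inv_in
      by (auto simp: comp_def)
    from harmonic_on_Re[OF oS this]
    show "harmonic_on ?\<Omega> (\<lambda>x. Re (h (spiral_inv s (of_plane x))))" unfolding spiral_domain_def .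
    show "Re (h (spiral_inv s (of_plane x))) = u x" if "x \<in> ?\<Omega>" for x
      using that h(2)[OF spiral_inv_in[OF ofS[OF that]]] by (simp add: u_def)
  qed
  have cl: "closure ?\<Omega> = ?\<Omega> \<union> frontier ?\<Omega>" by (rule closure_open_frontier[OF o\<Omega>])
  have "continuous_on (closure ?\<Omega>) u"
    unfolding continuous_on_def
  proof
    fix a assume "a \<in> closure ?\<Omega>"
    then consider "a \<in> ?\<Omega>" | "a \<in> frontier ?\<Omega>" using cl by blast
    thus "(u \<longlongrightarrow> u a) (at a within closure ?\<Omega>)"
    proof cases
      case 1
      thus ?thesis using harmonic_on_continuous[OF harm] by (simp add: isCont_def tendsto_within_subset[of _ _ _ UNIV])
    next
      case 2
      \<comment> \<open>Approach along the frontier is continuity of \<open>f\<close>; approach from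
        inside is the limit of the Poisson integral.\<close>
      have "(f \<longlongrightarrow> f a) (at a within frontier ?\<Omega>)"
        using fc 2 unfolding continuous_on_def by blast
      hence "(u \<longlongrightarrow> f a) (at a within frontier ?\<Omega>)"
        by (rule Lim_transform_eventually) (auto simp: eventually_at_filter uf)
      moreover have "(u \<longlongrightarrow> f a) (at a within ?\<Omega>)"
        unfolding tendsto_at_iff_sequentially comp_def
      proof (intro allI impI)
        fix x :: "nat \<Rightarrow> plane" assume x: "\<forall>i. x i \<in> ?\<Omega> - {a}" and lim: "x \<longlonglongrightarrow> a"
        define V where "V n = spiral_inv s (of_plane (x n))" for n
        have V: "V n \<in> right_halfplane" "spiral s (V n) = of_plane (x n)" for n
          using x ofS by (auto simp: V_def spiral_inv_in spiral_spiral_inv)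
        have "(\<lambda>n. spiral s (V n)) \<longlonglongrightarrow> of_plane a" unfolding V by (intro tendsto_intros lim)
        moreover have "of_plane a \<in> frontier ?S"
          using 2 unfolding frontier_spiral_domain[OF s] to_plane_image_iff' .
        ultimately have "(\<lambda>n. poisson F (V n)) \<longlonglongrightarrow> f (to_plane (of_plane a))"
          by (rule poisson_boundary_limit[OF s V(1) _ _ fc' F_meas F_bd Ff])
        moreover have "u (x n) = poisson F (V n)" for n using x by (simp add: u_def V_def)
        ultimately show "(\<lambda>n. u (x n)) \<longlonglongrightarrow> f a" by simp
      qed
      ultimately show ?thesis unfolding cl uf[OF 2] at_within_union by (intro filterlim_sup)
    qed
  qed
  moreover have "\<bar>u x\<bar> \<le> B" if "x \<in> closure ?\<Omega>" for x
    using that B(1) cl poisson_bound[OF F_meas F_bd] by (auto simp: u_def)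
  hence "bounded (u ` closure ?\<Omega>)" unfolding bounded_iff by auto
  ultimately show "\<exists>u. dirichlet_solution ?\<Omega> f u"
    unfolding dirichlet_solution_def using harm uf by blast
qed

subsection \<open>Harmonic measure\<close>

text \<open>The centre of the disc goes to 1, the parameter of the pole, so that a mean value over
  circles evaluates at the pole. The boundary points 1 and -1 correspond to the ends infinity and 0
  of the half-plane.\<close>

definition cayley :: "complex \<Rightarrow> complex" where
  "cayley z = (1 + z) / (1 - z)"

lemma Re_cayley: "Re (cayley z) = (1 - (norm z)\<^sup>2) / (norm (1 - z))\<^sup>2"
  unfolding cayley_def Re_divide cmod_power2 by (simp add: power2_eq_square algebra_simps)

lemma cayley_right_halfplane: "norm z < 1 \<Longrightarrow> cayley z \<in> right_halfplane"
proof -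
  assume z: "norm z < 1"
  hence "1 - z \<noteq> 0" by auto
  thus ?thesis using z abs_square_less_1[of "norm z"]
    by (auto simp: right_halfplane_def Re_cayley intro!: divide_pos_pos)
qed

lemma cayley_boundary:
  assumes "norm z = 1" "z \<noteq> 1" "z \<noteq> -1"
  shows "cayley z \<in> closed_halfplane" "cayley z \<notin> right_halfplane"
proof -
  have "1 + z \<noteq> 0" using assms(3) by (metis add_eq_0_iff)
  thus "cayley z \<in> closed_halfplane" "cayley z \<notin> right_halfplane"
    using assms by (auto simp: closed_halfplane_def right_halfplane_def Re_cayley) (auto simp: cayley_def)
qed

definition circle_times :: "real set" where
  "circle_times = {0<..<1} - {1/2}"

definition circle_point :: "real \<Rightarrow> complex" where
  "circle_point t = exp (2 * of_real pi * \<i> * of_real t)"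

lemma norm_circle_point [simp]: "norm (circle_point t) = 1"
  by (simp add: circle_point_def)

lemma circle_point_ne:
  assumes "t \<in> circle_times" shows "circle_point t \<noteq> 1" "circle_point t \<noteq> -1"
proof -
  show "circle_point t \<noteq> 1"
  proof
    assume "circle_point t = 1"
    then obtain n :: int where "2 * pi * t = of_int (2 * n) * pi"
      by (auto simp: circle_point_def exp_eq_1)
    hence "t = of_int n" by simp
    thus False using assms by (auto simp: circle_times_def)
  qed
  show "circle_point t \<noteq> -1"
  proof
    assume "circle_point t = -1"
    hence "circle_point t * circle_point t = 1" by simp
    hence "exp (2 * of_real pi * \<i> * of_real t + 2 * of_real pi * \<i> * of_real t) = (1::complex)"
      unfolding circle_point_def exp_add .
    then obtain n :: int where "2 * (2 * pi * t) = of_int (2 * n) * pi"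
      unfolding exp_eq_1 by auto
    hence t: "2 * t = of_int n" by simp
    hence "0 < n" "n < 2" using assms by (auto simp: circle_times_def)
    hence "n = 1" by linarith
    thus False using t assms by (auto simp: circle_times_def)
  qed
qed

text \<open>The exceptional parameters correspond to \<open>z = 1\<close> and \<open>z = -1\<close>, the prime ends over the two
  limit circles; there \<open>boundary_map\<close> has the junk value 0.\<close>

definition boundary_map :: "real \<Rightarrow> real \<Rightarrow> plane" where
  "boundary_map s t = indicator circle_times t *\<^sub>R to_plane (spiral s (cayley (circle_point t)))"

lemma boundary_map_eq: "t \<in> circle_times \<Longrightarrow> boundary_map s t = to_plane (spiral s (cayley (circle_point t)))"
  by (simp add: boundary_map_def)

lemma open_circle_times: "open circle_times"
  unfolding circle_times_def by (intro open_Diff) auto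

lemma boundary_map_measurable [measurable]: "boundary_map s \<in> borel_measurable borel"
  unfolding boundary_map_def[abs_def]
proof (rule borel_measurable_continuous_on_indicator)
  show "circle_times \<in> sets borel" using open_circle_times by (rule borel_open)
  have "continuous_on circle_times (\<lambda>t. cayley (circle_point t))"
    unfolding cayley_def using circle_point_ne
    by (intro continuous_intros) (auto simp: circle_point_def intro!: continuous_intros)
  thus "continuous_on circle_times (\<lambda>t. to_plane (spiral s (cayley (circle_point t))))"
    by (intro continuous_on_to_plane continuous_on_compose2[OF continuous_on_spiral])
      (auto intro!: cayley_boundary(1) circle_point_ne)
qed

abbreviation unit_lborel :: "real measure" where
  "unit_lborel \<equiv> restrict_space lborel {0..1}"

lemma prob_space_unit: "prob_space unit_lborel"
  by (rule prob_spaceI) (simp add: emeasure_restrict_space space_restrict_space)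

lemma AE_circle_times: "AE t in unit_lborel. t \<in> circle_times"
proof -
  have "finite {0, 1/2, 1::real}" by simp
  hence "{0, 1/2, 1::real} \<in> null_sets lborel" by (rule finite_imp_null_set_lborel)
  hence "AE t in lborel. t \<notin> {0, 1/2, 1::real}" by (rule AE_not_in)
  hence "AE t in lborel. t \<in> {0..1} \<longrightarrow> t \<in> circle_times"
    by eventually_elim (auto simp: circle_times_def)
  thus ?thesis by (subst AE_restrict_space_iff) auto
qed

definition spiral_measure :: "real \<Rightarrow> plane measure" where
  "spiral_measure s = distr unit_lborel borel (boundary_map s)"

lemma boundary_map_measurable': "boundary_map s \<in> measurable unit_lborel borel"
  using measurable_restrict_space1[of "boundary_map s" lborel borel] by simp

lemma emeasure_spiral_measure_0:
  assumes A: "A \<in> sets borel" and "\<And>t. t \<in> circle_times \<Longrightarrow> boundary_map s t \<notin> A"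
  shows "emeasure (spiral_measure s) A = 0"
proof -
  have "AE t in unit_lborel. boundary_map s t \<notin> A"
    using AE_circle_times by eventually_elim (rule assms(2))
  hence "AE x in spiral_measure s. x \<notin> A"
    unfolding spiral_measure_def using A
    by (subst AE_distr_iff[OF boundary_map_measurable']) auto
  moreover have "A \<in> sets (spiral_measure s)" using A by (simp add: spiral_measure_def)
  ultimately show ?thesis by (simp add: AE_iff_null_sets null_setsD1)
qed

lemma boundary_map_in_frontier:
  assumes "\<bar>s\<bar> = 1" "t \<in> circle_times"
  shows "boundary_map s t \<in> frontier (spiral_domain s)"
  unfolding boundary_map_eq[OF assms(2)] frontier_spiral_domain[OF assms(1)] to_plane_image_iff
  by (intro spiral_boundary_in_frontier assms cayley_boundary circle_point_ne norm_circle_point)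

definition spiral_pole :: "real \<Rightarrow> plane" where
  "spiral_pole s = to_plane (spiral s 1)"

lemma spiral_pole_in: "spiral_pole s \<in> spiral_domain s"
  by (simp add: spiral_pole_def spiral_domain_def right_halfplane_def)

lemma holomorphic_on_cayley: "cayley holomorphic_on ball 0 1"
  unfolding cayley_def by (intro holomorphic_intros) auto

text \<open>An arbitrary solution \<open>u\<close> is pulled back to the disc, where it is bounded
  and has the mean value property. Except at the two points over the ends, the conformal map extends
  continuously to the circle and \<open>u\<close> is continuous up to the frontier, so the radial
  limits are the boundary data along \<open>boundary_map\<close>.\<close>

theorem harmonic_measure_spiral:
  assumes s: "\<bar>s\<bar> = 1"
  shows "harmonic_measure (spiral_domain s) (spiral_pole s) (spiral_measure s)"
  unfolding harmonic_measure_def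
proof (intro conjI allI impI)
  let ?\<Omega> = "spiral_domain s" and ?S = "spiral s ` right_halfplane"
  interpret U: prob_space unit_lborel by (rule prob_space_unit)
  show "prob_space (spiral_measure s)"
    unfolding spiral_measure_def by (rule U.prob_space_distr[OF boundary_map_measurable'])
  show "sets (spiral_measure s) = sets borel" by (simp add: spiral_measure_def)
  show "emeasure (spiral_measure s) (- frontier ?\<Omega>) = 0"
    by (rule emeasure_spiral_measure_0) (use boundary_map_in_frontier[OF s] in auto)
  fix f u
  assume "continuous_on (frontier ?\<Omega>) f \<and> bounded (f ` frontier ?\<Omega>) \<and> dirichlet_solution ?\<Omega> f u"
  hence fc: "continuous_on (frontier ?\<Omega>) f"
    and uc: "continuous_on (closure ?\<Omega>) u" and ub: "bounded (u ` closure ?\<Omega>)"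
    and uh: "harmonic_on ?\<Omega> u" and uf: "\<And>x. x \<in> frontier ?\<Omega> \<Longrightarrow> u x = f x"
    by (auto simp: dirichlet_solution_def)
  obtain B where B: "\<And>x. x \<in> closure ?\<Omega> \<Longrightarrow> \<bar>u x\<bar> \<le> B"
    using ub unfolding bounded_iff by auto
  have oS: "open ?S" by (rule open_spiral_image[OF s])
  obtain q where q: "q holomorphic_on ?S"
    "\<And>z. z \<in> ?S \<Longrightarrow> ((\<lambda>z. u (to_plane z)) has_derivative (\<lambda>h. Re (q z * h))) (at z)"
    using harmonic_onE[OF oS] uh unfolding spiral_domain_def by blast
  define P where "P z = spiral s (cayley z)" for z
  have PS: "P z \<in> ?S" if "z \<in> ball 0 1" for z
    unfolding P_def using that by (intro imageI cayley_right_halfplane) simp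
  have P: "P holomorphic_on ball 0 1"
    unfolding P_def using holomorphic_on_compose_gen[OF holomorphic_on_cayley holomorphic_on_spiral]
      cayley_right_halfplane by (auto simp: comp_def image_subset_iff)
  have P': "deriv P holomorphic_on ball 0 1" by (rule holomorphic_deriv[OF P open_ball])
  define v where "v z = u (to_plane (P z))" for z
  let ?g = "\<lambda>y. indicator (frontier ?\<Omega>) y * f y"
  have g_meas: "?g \<in> borel_measurable borel"
    using borel_measurable_continuous_on_indicator[OF _ fc] by simp
  have "v 0 = (\<integral>t. ?g (boundary_map s t) \<partial>unit_lborel)"
  proof (rule harmonic_mean_value_boundary)
    show "(\<lambda>z. q (P z) * deriv P z) holomorphic_on ball 0 1"
      using holomorphic_on_compose_gen[OF P q(1)] PS
      by (intro holomorphic_on_mult P') (auto simp: comp_def image_subset_iff)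
    show "(v has_derivative (\<lambda>h. Re (q (P z) * deriv P z * h))) (at z)" if z: "z \<in> ball 0 1" for z
    proof -
      have "(P has_derivative (\<lambda>h. deriv P z * h)) (at z)"
        using holomorphic_derivI[OF P open_ball z] by (simp add: has_field_derivative_def)
      from has_derivative_compose[OF this q(2)[OF PS[OF z]]]
      show ?thesis unfolding v_def by (simp add: mult.assoc)
    qed
    show "\<bar>v z\<bar> \<le> B" if "z \<in> ball 0 1" for z
      unfolding v_def
      by (intro B subsetD[OF closure_subset]) (use PS[OF that] in \<open>simp add: spiral_domain_def\<close>)
    show "(\<lambda>t. ?g (boundary_map s t)) \<in> borel_measurable borel"
      by (rule measurable_compose[OF boundary_map_measurable g_meas])
    show "AE t in unit_lborel. ((\<lambda>r. v (of_real r * exp (2 * of_real pi * \<i> * of_real t))) \<longlongrightarrow> ?g (boundary_map s t)) (at_left 1)"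
      using AE_circle_times
    proof eventually_elim
      case (elim t)
      have e: "eventually (\<lambda>r. r \<in> {0<..<1::real}) (at_left 1)"
        by (rule eventually_at_leftI[of 0]) auto
      have ne: "1 - circle_point t \<noteq> 0" using circle_point_ne(1)[OF elim] by auto
      have "((\<lambda>r. cayley (of_real r * circle_point t)) \<longlongrightarrow> cayley (of_real 1 * circle_point t)) (at_left 1)"
        unfolding cayley_def using ne by (intro tendsto_intros) auto
      hence "((\<lambda>r. P (of_real r * circle_point t)) \<longlongrightarrow> spiral s (cayley (circle_point t))) (at_left 1)"
        unfolding P_def
      proof (intro continuous_on_tendsto_compose[OF continuous_on_spiral])
        show "cayley (circle_point t) \<in> closed_halfplane"
          by (intro cayley_boundary circle_point_ne elim norm_circle_point)
        show "\<forall>\<^sub>F r in at_left 1. cayley (of_real r * circle_point t) \<in> closed_halfplane"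
          using e by eventually_elim (auto intro!: right_halfplane_closed cayley_right_halfplane simp: norm_mult)
      qed simp
      hence "((\<lambda>r. to_plane (P (of_real r * circle_point t))) \<longlongrightarrow> boundary_map s t) (at_left 1)"
        unfolding boundary_map_eq[OF elim] by (rule tendsto_to_plane)
      hence "((\<lambda>r. u (to_plane (P (of_real r * circle_point t)))) \<longlongrightarrow> u (boundary_map s t)) (at_left 1)"
      proof (rule continuous_on_tendsto_compose[OF uc])
        show "boundary_map s t \<in> closure ?\<Omega>"
          using boundary_map_in_frontier[OF s elim] by (simp add: frontier_def)
        show "\<forall>\<^sub>F r in at_left 1. to_plane (P (of_real r * circle_point t)) \<in> closure ?\<Omega>"
          using e by eventually_elim
            (intro subsetD[OF closure_subset], auto simp: spiral_domain_def norm_mult intro!: PS)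
      qed
      thus ?case using boundary_map_in_frontier[OF s elim]
        by (simp add: v_def uf circle_point_def)
    qed
  qed
  also have "\<dots> = (\<integral>y. ?g y \<partial>spiral_measure s)"
    unfolding spiral_measure_def by (rule integral_distr[symmetric, OF boundary_map_measurable' g_meas])
  finally show "u (spiral_pole s) = (\<integral>y. ?g y \<partial>spiral_measure s)"
    by (simp add: v_def P_def cayley_def spiral_pole_def)
qed

subsection \<open>The Green function\<close>

text \<open>Conformal transplant of the Green function of the right half-plane with pole 1. At the
  pole the convention \<open>ln 0 = 0\<close> gives the value 0, which keeps the function
  nonnegative throughout the domain.\<close>

definition spiral_green :: "real \<Rightarrow> plane \<Rightarrow> real" where
  "spiral_green s x = (let V = spiral_inv s (of_plane x) in - ln (norm ((V - 1) / (V + 1))) / (2 * pi))"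

lemma halfplane_plus_one_nz: "V \<in> right_halfplane \<Longrightarrow> V + 1 \<noteq> 0"
  by (auto simp: right_halfplane_def complex_eq_iff)

lemma norm_cayley_inverse_less:
  assumes "V \<in> right_halfplane" shows "norm ((V - 1) / (V + 1)) < 1"
proof -
  have "(norm (V - 1))\<^sup>2 < (norm (V + 1))\<^sup>2"
    using assms unfolding cmod_power2 by (simp add: right_halfplane_def power2_eq_square algebra_simps)
  hence "norm (V - 1) < norm (V + 1)" by (rule power_less_imp_less_base) simp
  thus ?thesis using halfplane_plus_one_nz[OF assms] by (simp add: norm_divide)
qed

lemma spiral_green_nonneg:
  assumes "x \<in> spiral_domain s" shows "spiral_green s x \<ge> 0"
proof -
  define V where "V = spiral_inv s (of_plane x)"
  have "V \<in> right_halfplane"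
    unfolding V_def using assms by (intro spiral_inv_in) (simp add: spiral_domain_def to_plane_image_iff')
  from norm_cayley_inverse_less[OF this] have "ln (norm ((V - 1) / (V + 1))) \<le> 0"
    using halfplane_plus_one_nz[OF \<open>V \<in> right_halfplane\<close>]
    by (cases "V = 1") (auto intro!: ln_less_zero less_imp_le simp del: norm_divide)
  thus ?thesis by (simp add: spiral_green_def Let_def V_def divide_nonpos_pos)
qed

text \<open>The difference quotient of \<open>spiral\<close> at 1 is holomorphic and has no zero:
  off 1 by injectivity, at 1 by the nonzero derivative. Hence it has a holomorphic logarithm on the
  convex half-plane, whose real part is the difference between the logarithmic poles in the two
  coordinates.\<close>

lemma green_regular_part:
  assumes s: "\<bar>s\<bar> = 1"
  shows "\<exists>h. harmonic_on (spiral_domain s) h \<and>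
    (\<forall>x\<in>spiral_domain s - {spiral_pole s}. spiral_green s x = h x - ln (dist x (spiral_pole s)) / (2 * pi))"
proof -
  let ?S = "spiral s ` right_halfplane"
  define m where "m z = (if z = 1 then deriv (spiral s) 1 else (spiral s z - spiral s 1) / (z - 1))" for z
  have one: "1 \<in> right_halfplane" by (simp add: right_halfplane_def)
  have "m holomorphic_on right_halfplane"
    unfolding m_def by (rule pole_lemma_open[OF holomorphic_on_spiral open_right_halfplane])
  moreover have m_nz: "m z \<noteq> 0" if "z \<in> right_halfplane" for z
  proof (cases "z = 1")
    case True
    have "deriv (spiral s) 1 = spiral s 1 * (of_real s * \<i> / (strip_map 1 * 1))"
      by (rule DERIV_imp_deriv[OF has_field_derivative_spiral[OF right_halfplane_closed[OF one]]])
    thus ?thesis using True s strip_map_nz[OF right_halfplane_closed[OF one]] by (auto simp: m_def)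
  next
    case False
    thus ?thesis using inj_on_spiral_open[OF s] one that by (auto simp: m_def inj_on_def)
  qed
  ultimately obtain l where l: "l holomorphic_on right_halfplane" "\<And>z. z \<in> right_halfplane \<Longrightarrow> exp (l z) = m z"
    using holomorphic_logarithm_exists[OF convex_right_halfplane open_right_halfplane _ _ one] by metis
  define H where "H z = (l z + Ln (z + 1)) / (2 * of_real pi)" for z
  have "H holomorphic_on right_halfplane"
    unfolding H_def by (intro holomorphic_intros l) (auto simp: right_halfplane_def complex_nonpos_Reals_iff)
  hence Hol: "(\<lambda>z. H (spiral_inv s z)) holomorphic_on ?S"
    using holomorphic_on_compose_gen[OF holomorphic_on_spiral_inv[OF s]] spiral_inv_in
    by (auto simp: comp_def image_subset_iff)
  show ?thesis
  proof (intro exI conjI ballI)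
    show "harmonic_on (spiral_domain s) (\<lambda>x. Re (H (spiral_inv s (of_plane x))))"
      unfolding spiral_domain_def by (rule harmonic_on_Re[OF open_spiral_image[OF s] Hol])
    fix x assume x: "x \<in> spiral_domain s - {spiral_pole s}"
    define V where "V = spiral_inv s (of_plane x)"
    have xS: "of_plane x \<in> ?S" using x by (simp add: spiral_domain_def to_plane_image_iff')
    have V: "V \<in> right_halfplane" "spiral s V = of_plane x"
      unfolding V_def using spiral_inv_in[OF xS] spiral_spiral_inv[OF xS] by auto
    have V1: "V \<noteq> 1" using x V(2) by (metis DiffD2 insertI1 spiral_pole_def to_plane_of_plane)
    have ne: "spiral s V \<noteq> spiral s 1" using inj_on_spiral_open[OF s] one V V1 by (auto simp: inj_on_def)
    have d: "dist x (spiral_pole s) = norm (spiral s V - spiral s 1)"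
      unfolding V(2) spiral_pole_def by (metis dist_norm dist_to_plane to_plane_of_plane)
    have "Re (l V) = ln (norm (exp (l V)))" by simp
    also have "\<dots> = ln (norm (spiral s V - spiral s 1)) - ln (norm (V - 1))"
      using l(2)[OF V(1)] V1 ne by (simp add: m_def norm_divide ln_div)
    finally have "Re (H V) = (ln (norm (spiral s V - spiral s 1)) - ln (norm (V - 1)) + ln (norm (V + 1))) / (2 * pi)"
      using halfplane_plus_one_nz[OF V(1)] by (simp add: H_def)
    moreover have "ln (norm ((V - 1) / (V + 1))) = ln (norm (V - 1)) - ln (norm (V + 1))"
      using halfplane_plus_one_nz[OF V(1)] V1 by (simp add: norm_divide ln_div)
    ultimately show "spiral_green s x = Re (H (spiral_inv s (of_plane x))) - ln (dist x (spiral_pole s)) / (2 * pi)"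
      unfolding d spiral_green_def Let_def V_def[symmetric] by (simp add: field_simps)
  qed
qed

section \<open>Boundary behaviour of the Green function\<close>

definition disc_coord :: "real \<Rightarrow> plane \<Rightarrow> complex" where
  "disc_coord s x = (spiral_inv s (of_plane x) - 1) / (spiral_inv s (of_plane x) + 1)"

lemma disc_coord_less: "x \<in> spiral_domain s \<Longrightarrow> norm (disc_coord s x) < 1"
  unfolding disc_coord_def
  by (intro norm_cayley_inverse_less spiral_inv_in) (simp add: spiral_domain_def to_plane_image_iff')

lemma cayley_disc_coord:
  assumes "x \<in> spiral_domain s" shows "to_plane (spiral s (cayley (disc_coord s x))) = x"
proof -
  have xS: "of_plane x \<in> spiral s ` right_halfplane" using assms by (simp add: spiral_domain_def to_plane_image_iff')
  define V where "V = spiral_inv s (of_plane x)"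
  have V: "V \<in> right_halfplane" "spiral s V = of_plane x"
    unfolding V_def using spiral_inv_in[OF xS] spiral_spiral_inv[OF xS] by auto
  have "cayley ((V - 1) / (V + 1)) = V"
  proof -
    have p: "V + 1 \<noteq> 0" by (rule halfplane_plus_one_nz[OF V(1)])
    have "1 + (V - 1) / (V + 1) = 2 * V / (V + 1)" "1 - (V - 1) / (V + 1) = 2 / (V + 1)"
      using p by (simp_all add: field_simps)
    thus ?thesis unfolding cayley_def using p by simp
  qed
  thus ?thesis unfolding disc_coord_def V_def[symmetric] by (simp add: V(2))
qed

lemma continuous_on_spiral_cayley: "continuous_on (ball 0 1) (\<lambda>z. to_plane (spiral s (cayley z)))"
  by (intro continuous_intros continuous_on_compose2[OF continuous_on_spiral
        holomorphic_on_imp_continuous_on[OF holomorphic_on_cayley]])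
     (auto intro!: right_halfplane_closed cayley_right_halfplane)

text \<open>Properness of the conformal map: a limit of disc coordinates inside the disc would make
  the frontier point an interior one, by continuity. So the Green function vanishes at all of the
  frontier, E included, without any boundary extension of the map.\<close>

lemma disc_coord_boundary:
  assumes s: "\<bar>s\<bar> = 1" and z: "z \<in> frontier (spiral_domain s)"
  shows "((\<lambda>x. norm (disc_coord s x)) \<longlongrightarrow> 1) (at z within spiral_domain s)"
  unfolding tendsto_at_iff_sequentially comp_def
proof (intro allI impI)
  fix x :: "nat \<Rightarrow> plane" assume x: "\<forall>i. x i \<in> spiral_domain s - {z}" and lim: "x \<longlonglongrightarrow> z"
  let ?d = "\<lambda>n. disc_coord s (x n)"
  have d: "norm (?d n) < 1" for n using disc_coord_less x by blast
  show "(\<lambda>n. norm (?d n)) \<longlonglongrightarrow> 1"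
  proof (rule LIMSEQ_of_subsequences)
    fix r0 :: "nat \<Rightarrow> nat" assume r0: "strict_mono r0"
    have "bounded (range (\<lambda>n. ?d (r0 n)))" using d less_imp_le by (auto simp: bounded_iff intro!: exI[of _ 1])
    then obtain l r where r: "strict_mono (r :: nat \<Rightarrow> nat)" "((\<lambda>n. ?d (r0 n)) \<circ> r) \<longlonglongrightarrow> l"
      using bounded_imp_convergent_subsequence by metis
    hence l: "(\<lambda>n. ?d (r0 (r n))) \<longlonglongrightarrow> l" by (simp add: comp_def)
    have "norm l \<le> 1" by (rule LIMSEQ_le_const2[OF tendsto_norm[OF l]]) (use d less_imp_le in blast)
    moreover have "\<not> norm l < 1"
    proof
      assume l1: "norm l < 1"
      have "(\<lambda>n. to_plane (spiral s (cayley (?d (r0 (r n)))))) \<longlonglongrightarrow> to_plane (spiral s (cayley l))"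
        by (rule continuous_on_tendsto_compose[OF continuous_on_spiral_cayley l]) (use d l1 in auto)
      moreover have "to_plane (spiral s (cayley (?d (r0 (r n))))) = x (r0 (r n))" for n
        using cayley_disc_coord x by blast
      moreover have "(\<lambda>n. x (r0 (r n))) \<longlonglongrightarrow> z"
        using LIMSEQ_subseq_LIMSEQ[OF lim strict_mono_o[OF r0 r(1)]] by (simp add: comp_def)
      ultimately have "z = to_plane (spiral s (cayley l))" using LIMSEQ_unique by simp
      hence "z \<in> spiral_domain s" using cayley_right_halfplane[OF l1] by (simp add: spiral_domain_def)
      thus False using z open_spiral_domain[OF s] by (simp add: frontier_def interior_open)
    qed
    ultimately have "norm l = 1" by simp
    thus "\<exists>r'. strict_mono (r' :: nat \<Rightarrow> nat) \<and> (\<lambda>n. norm (?d (r0 (r' n)))) \<longlonglongrightarrow> 1"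
      using tendsto_norm[OF l] r(1) by auto
  qed
qed

lemma spiral_green_disc: "spiral_green s x = - ln (norm (disc_coord s x)) / (2 * pi)"
  by (simp add: spiral_green_def disc_coord_def Let_def)

theorem green_function_spiral:
  assumes s: "\<bar>s\<bar> = 1"
  shows "green_function (spiral_domain s) (spiral_pole s) (spiral_green s)"
  unfolding green_function_def
proof (intro conjI ballI allI impI)
  show "\<exists>h. harmonic_on (spiral_domain s) h \<and>
    (\<forall>x\<in>spiral_domain s - {spiral_pole s}. spiral_green s x = h x - ln (dist x (spiral_pole s)) / (2 * pi))"
    by (rule green_regular_part[OF s])
  fix z assume z: "z \<in> frontier (spiral_domain s)"
  have "((\<lambda>x. - ln (norm (disc_coord s x)) / (2 * pi)) \<longlongrightarrow> - ln 1 / (2 * pi)) (at z within spiral_domain s)"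
    by (intro tendsto_intros disc_coord_boundary[OF s z]) auto
  thus "(spiral_green s \<longlongrightarrow> 0) (at z within spiral_domain s)"
    unfolding spiral_green_disc[abs_def] by simp
next
  fix r :: real assume r: "r > 0"
  have "isCont (\<lambda>z. to_plane (spiral s (cayley z))) 0"
    using continuous_on_spiral_cayley[of s] by (simp add: continuous_on_eq_continuous_at)
  \<comment> \<open>Points with disc coordinate below \<open>d\<close> lie in the ball around the
    pole; outside that ball the logarithm is therefore bounded below by \<open>ln d\<close>.\<close>
  then obtain d where d: "d > 0" "\<And>z. dist z 0 < d \<Longrightarrow> dist (to_plane (spiral s (cayley z))) (spiral_pole s) < r"
    unfolding continuous_at_eps_delta using r by (auto simp: spiral_pole_def cayley_def)
  show "bounded (spiral_green s ` (spiral_domain s - ball (spiral_pole s) r))"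
    unfolding bounded_iff
  proof (intro exI ballI)
    fix y assume "y \<in> spiral_green s ` (spiral_domain s - ball (spiral_pole s) r)"
    then obtain x where x: "x \<in> spiral_domain s" "dist (spiral_pole s) x \<ge> r" "y = spiral_green s x" by auto
    have "\<not> norm (disc_coord s x) < d"
      using d(2)[of "disc_coord s x"] cayley_disc_coord[OF x(1)] x(2) by (auto simp: dist_commute)
    hence "norm (disc_coord s x) \<ge> d" by simp
    hence "ln (norm (disc_coord s x)) \<ge> ln d" using d(1) by (subst ln_le_cancel_iff) auto
    hence "y \<le> - ln d / (2 * pi)" unfolding x spiral_green_disc by (intro divide_right_mono) auto
    moreover have "y \<ge> 0" unfolding x(3) by (rule spiral_green_nonneg[OF x(1)])
    ultimately show "norm y \<le> - ln d / (2 * pi)" by simp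
  qed
qed

subsection \<open>Decay of the energy\<close>

lemma GDERIV_unique: "GDERIV u x :> D \<Longrightarrow> GDERIV u x :> D' \<Longrightarrow> D = D'"
proof -
  assume "GDERIV u x :> D" "GDERIV u x :> D'"
  hence "(\<lambda>h. h \<bullet> D) = (\<lambda>h. h \<bullet> D')" unfolding gderiv_def by (rule has_derivative_unique)
  thus "D = D'" by (metis vector_eq_ldot)
qed

lemma gradient_eq: "GDERIV u x :> D \<Longrightarrow> gradient u x = D"
  unfolding gradient_def using GDERIV_unique by (auto intro!: the_equality)

lemma gradient_at_minimum:
  assumes "\<And>y. u x \<le> u y" shows "gradient u x = 0"
proof (cases "\<exists>D. GDERIV u x :> D")
  case True
  then obtain D where D: "GDERIV u x :> D" by blast
  hence "(\<lambda>h. h \<bullet> D) = (\<lambda>h. 0)" unfolding gderiv_def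
    by (rule differential_zero_maxmin[of x UNIV u, rotated 2]) (use assms in auto)
  hence "D = 0" by (metis inner_eq_zero_iff)
  thus ?thesis using gradient_eq[OF D] by simp
qed (simp add: gradient_def)

lemma zero_extension_spiral_green_nonneg: "zero_extension (spiral_domain s) (spiral_green s) x \<ge> 0"
  by (simp add: zero_extension_def spiral_green_nonneg)

text \<open>On the frontier the extended Green function attains its minimum 0, so its gradient is either
  undefined (and then 0 by convention) or 0.\<close>

lemma gradient_outside:
  assumes "x \<notin> spiral_domain s" shows "gradient (zero_extension (spiral_domain s) (spiral_green s)) x = 0"
  by (rule gradient_at_minimum) (use assms zero_extension_spiral_green_nonneg in \<open>simp add: zero_extension_def\<close>)

lemma Re_of_real_mult: "Re (of_real a * w) = a * Re w"
  by simp

text \<open>Chain rule: the half-plane contributes 2 / (V^2 - 1) divided by 2 pi, and the inverse of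
  the conformal map contributes V * \<open>strip_map V\<close> / \<open>spiral s V\<close> up to a
  factor of modulus 1.\<close>

lemma norm_gradient_spiral_green:
  assumes s: "\<bar>s\<bar> = 1" and V: "V \<in> right_halfplane" "norm V > 1"
  shows "norm (gradient (zero_extension (spiral_domain s) (spiral_green s)) (to_plane (spiral s V)))
     = norm V * norm (strip_map V) / (pi * norm (spiral s V) * norm (V\<^sup>2 - 1))"
proof -
  let ?S = "spiral s ` right_halfplane"
  let ?z = "spiral s V"
  define d where "d = spiral s V * (of_real s * \<i> / (strip_map V * V))"
  have V0: "V \<noteq> 0" using V by auto
  have K: "V \<in> closed_halfplane" using V right_halfplane_closed by blast
  have d: "(spiral s has_field_derivative d) (at V)"
    unfolding d_def by (rule has_field_derivative_spiral[OF K])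
  have dnz: "d \<noteq> 0" using strip_map_nz[OF K] V0 s by (auto simp: d_def)
  have zS: "?z \<in> ?S" using V by blast
  have oS: "open ?S" by (rule open_spiral_image[OF s])
  have inv: "spiral_inv s ?z = V" by (rule spiral_inv_spiral[OF s V(1)])
  have dinv: "(spiral_inv s has_field_derivative inverse d) (at ?z)"
    by (rule has_field_derivative_inverse_strong[OF d dnz open_right_halfplane V(1)
          holomorphic_on_imp_continuous_on[OF holomorphic_on_spiral]])
      (rule spiral_inv_spiral[OF s])
  have "((\<lambda>V. Ln ((V - 1) / (V + 1))) has_field_derivative (2 / (V\<^sup>2 - 1))) (at V)"
  proof -
    have p: "V + 1 \<noteq> 0" by (rule halfplane_plus_one_nz[OF V(1)])
    have sq: "V\<^sup>2 - 1 = (V - 1) * (V + 1)" by (simp add: power2_eq_square algebra_simps)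
    have V1: "V \<noteq> 1" using V by auto
    \<comment> \<open>This is where |V| > 1 enters: it keeps the quotient off the branch cut of the
      principal logarithm.\<close>
    have "Re ((V - 1) / (V + 1)) = ((norm V)\<^sup>2 - 1) / (norm (V + 1))\<^sup>2"
      unfolding Re_divide cmod_power2 by (simp add: power2_eq_square algebra_simps)
    moreover have "(norm V)\<^sup>2 > 1" using V(2) by (simp add: one_less_power)
    ultimately have "Re ((V - 1) / (V + 1)) > 0" using p by (simp add: divide_pos_pos)
    hence nn: "(V - 1) / (V + 1) \<notin> \<real>\<^sub>\<le>\<^sub>0" by (auto simp: complex_nonpos_Reals_iff)
    have "((\<lambda>V. (V - 1) / (V + 1)) has_field_derivative (2 / (V + 1)\<^sup>2)) (at V)"
      using p by (auto intro!: derivative_eq_intros simp: power2_eq_square)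
    note chain = DERIV_chain2[OF has_field_derivative_Ln[OF nn] this]
    have "inverse (a / b) * (2 / b\<^sup>2) = 2 / (a * b)" if "a \<noteq> 0" "b \<noteq> 0" for a b :: complex
      using that by (simp add: power2_eq_square field_simps)
    hence "inverse ((V - 1) / (V + 1)) * (2 / (V + 1)\<^sup>2) = 2 / (V\<^sup>2 - 1)"
      unfolding sq using p V1 by (metis eq_iff_diff_eq_0)
    from DERIV_cong[OF chain this] show ?thesis .
  qed
  hence "((\<lambda>V. Ln ((V - 1) / (V + 1))) has_field_derivative (2 / (V\<^sup>2 - 1))) (at (spiral_inv s ?z))"
    unfolding inv .
  from DERIV_chain2[OF this dinv]
  have "((\<lambda>z. Ln ((spiral_inv s z - 1) / (spiral_inv s z + 1))) has_field_derivative (2 / (V\<^sup>2 - 1) * inverse d)) (at ?z)" .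
  from DERIV_cmult[OF this, of "- 1 / (2 * of_real pi)"]
  have "((\<lambda>z. - 1 / (2 * of_real pi) * Ln ((spiral_inv s z - 1) / (spiral_inv s z + 1))) has_derivative
      (\<lambda>h. (- 1 / (2 * of_real pi) * (2 / (V\<^sup>2 - 1) * inverse d)) * h)) (at ?z)" (is "(?f has_derivative (\<lambda>h. ?q * h)) _")
    unfolding has_field_derivative_def .
  hence Dre: "((\<lambda>z. Re (?f z)) has_derivative (\<lambda>h. Re (?q * h))) (at ?z)" by (rule has_derivative_Re)
  have ReL: "Re (- 1 / (2 * of_real pi) * w) = - Re w / (2 * pi)" for w
  proof -
    have "- 1 / (2 * complex_of_real pi) = of_real (- 1 / (2 * pi))" by simp
    moreover have "Re (of_real (- 1 / (2 * pi)) * w) = - 1 / (2 * pi) * Re w" by (rule Re_of_real_mult)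
    ultimately show ?thesis by (simp only:) simp
  qed
  let ?u = "zero_extension (spiral_domain s) (spiral_green s)"
  have "((\<lambda>z. ?u (to_plane z)) has_derivative (\<lambda>h. Re (?q * h))) (at ?z)"
  proof (rule has_derivative_transform_within_open[OF Dre])
    show "open (?S - {spiral s 1})" using oS by (intro open_Diff) auto
    show "?z \<in> ?S - {spiral s 1}"
    proof -
      have "1 \<in> right_halfplane" "V \<noteq> 1" using V by (auto simp: right_halfplane_def)
      hence "spiral s V \<noteq> spiral s 1" using inj_onD[OF inj_on_spiral_open[OF s] _ V(1)] by blast
      thus ?thesis using zS by simp
    qed
    fix z assume z: "z \<in> ?S - {spiral s 1}"
    define W where "W = spiral_inv s z"
    have W: "W \<in> right_halfplane" "spiral s W = z" using z by (auto simp: W_def spiral_inv_in spiral_spiral_inv)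
    hence "W \<noteq> 1" using z by auto
    hence "(W - 1) / (W + 1) \<noteq> 0" using halfplane_plus_one_nz[OF W(1)] by simp
    hence "Re (- 1 / (2 * of_real pi) * Ln ((W - 1) / (W + 1))) = - ln (norm ((W - 1) / (W + 1))) / (2 * pi)"
      using ReL[of "Ln ((W - 1) / (W + 1))"] by (simp only: Re_Ln not_False_eq_True)
    thus "Re (?f z) = ?u (to_plane z)"
      using z by (simp add: zero_extension_def spiral_domain_def spiral_green_def W_def Let_def)
  qed
  from gderiv_to_plane[OF this]
  have "gradient ?u (to_plane ?z) = to_plane (cnj ?q)"
    by (intro gradient_eq) simp
  hence "norm (gradient ?u (to_plane ?z)) = norm ?q" by (simp only: norm_to_plane complex_mod_cnj)
  also have "\<dots> = norm V * norm (strip_map V) / (pi * norm (spiral s V) * norm (V\<^sup>2 - 1))"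
    using s V0 strip_map_nz[OF K] by (simp add: d_def norm_mult norm_divide norm_inverse mult_ac)
  finally show ?thesis .
qed

text \<open>The gradient in the half-plane is of order |V|^(-2), and the inverse of the conformal
  map expands by about |V| ln |V|, which leaves ln |V| / |V|. The constant \<open>exp pi\<close>
  comes from the least modulus of \<open>spiral\<close>, and 5 from the height of the strip.\<close>

lemma gradient_bound:
  assumes s: "\<bar>s\<bar> = 1" and V: "V \<in> right_halfplane" "norm V \<ge> 2"
  shows "norm (gradient (zero_extension (spiral_domain s) (spiral_green s)) (to_plane (spiral s V)))
     \<le> exp pi * norm V * (ln (norm V) + 5) / ((norm V)\<^sup>2 - 1)"
proof -
  have K: "V \<in> closed_halfplane" using V right_halfplane_closed by blast
  have n2: "(norm V)\<^sup>2 > 1" using V by (simp add: one_less_power)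
  have st: "norm (strip_map V) \<le> ln (norm V) + 5"
  proof -
    have "V \<noteq> 0" using V by auto
    have "norm (strip_map V) \<le> \<bar>Re (strip_map V)\<bar> + \<bar>Im (strip_map V)\<bar>" by (rule cmod_le)
    moreover have "\<bar>Im (strip_map V)\<bar> \<le> 5" using Im_strip_map[OF K] by linarith
    moreover have "Re (strip_map V) = ln (norm V)" using \<open>V \<noteq> 0\<close> by (simp add: strip_map_def)
    moreover have "ln (norm V) \<ge> 0" using V by simp
    ultimately show ?thesis by linarith
  qed
  have sq: "(norm V)\<^sup>2 - 1 \<le> norm (V\<^sup>2 - 1)"
    using norm_triangle_ineq2[of "V\<^sup>2" 1] by (simp add: norm_power)
  have den: "exp (- pi) * ((norm V)\<^sup>2 - 1) \<le> pi * norm (spiral s V) * norm (V\<^sup>2 - 1)"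
  proof -
    have "1 * exp (- pi) \<le> pi * norm (spiral s V)"
      using norm_spiral_bounds(1)[OF s K] pi_gt3 by (intro mult_mono) auto
    thus ?thesis using sq n2 by (intro mult_mono) auto
  qed
  have "norm V * norm (strip_map V) / (pi * norm (spiral s V) * norm (V\<^sup>2 - 1))
    \<le> norm V * (ln (norm V) + 5) / (exp (- pi) * ((norm V)\<^sup>2 - 1))"
    using den st n2 by (intro frac_le mult_left_mono mult_nonneg_nonneg) (use order_trans[OF norm_ge_zero st] in auto)
  also have "\<dots> = exp pi * norm V * (ln (norm V) + 5) / ((norm V)\<^sup>2 - 1)"
    by (simp add: exp_minus field_simps)
  finally show ?thesis using norm_gradient_spiral_green[OF s V(1)] V(2) by simp
qed

text \<open>Modulus tending to 1 means that the argument of the strip coordinate tends to 0 and not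
  to pi. This singles out the end where V tends to infinity, and there \<open>gradient_bound\<close>
  decays.\<close>

lemma gradient_tendsto_0:
  assumes s: "\<bar>s\<bar> = 1" and x: "x \<in> to_plane ` sphere 0 1"
  shows "((\<lambda>y. norm (gradient (zero_extension (spiral_domain s) (spiral_green s)) y)) \<longlongrightarrow> 0) (at x within spiral_domain s)"
  unfolding tendsto_at_iff_sequentially comp_def
proof (intro allI impI)
  fix y :: "nat \<Rightarrow> plane" assume y: "\<forall>i. y i \<in> spiral_domain s - {x}" and lim: "y \<longlonglongrightarrow> x"
  define V where "V n = spiral_inv s (of_plane (y n))" for n
  have ofS: "of_plane (y n) \<in> spiral s ` right_halfplane" for n
    using y by (simp add: spiral_domain_def to_plane_image_iff')
  have V: "V n \<in> right_halfplane" "spiral s (V n) = of_plane (y n)" for n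
    using ofS by (auto simp: V_def spiral_inv_in spiral_spiral_inv)
  have K: "V n \<in> closed_halfplane" for n using V right_halfplane_closed by blast
  have ss: "s * s = 1" using s by (auto simp: abs_if split: if_splits)
  define a where "a n = Im (Ln (strip_map (V n)))" for n
  have "(\<lambda>n. norm (of_plane (y n))) \<longlonglongrightarrow> norm (of_plane x)" by (intro tendsto_intros lim)
  hence "(\<lambda>n. exp (- s * a n)) \<longlonglongrightarrow> 1"
    using x unfolding V(2)[symmetric] norm_spiral a_def by auto
  hence "(\<lambda>n. - s * ln (exp (- s * a n))) \<longlonglongrightarrow> - s * ln 1" by (intro tendsto_intros) auto
  moreover have "- s * ln (exp (- s * a n)) = a n" for n using ss by (simp add: mult.assoc[symmetric])
  ultimately have "a \<longlonglongrightarrow> - s * ln 1" by (simp only:)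
  hence a0: "a \<longlonglongrightarrow> 0" by simp
  have a: "0 < a n" "a n < pi" for n using Im_Ln_strip_map[OF K[of n]] by (auto simp: a_def)
  have Re_st: "Re (strip_map (V n)) \<ge> cos (a n) / a n" if "cos (a n) \<ge> 0" for n
  proof -
    let ?z = "strip_map (V n)"
    have nz: "?z \<noteq> 0" by (rule strip_map_nz[OF K])
    have z: "Re ?z = norm ?z * cos (a n)" "Im ?z = norm ?z * sin (a n)"
      unfolding a_def using nz Re_exp[of "Ln ?z"] Im_exp[of "Ln ?z"] by simp_all
    have "1 \<le> norm ?z * sin (a n)" using Im_strip_map(1)[OF K[of n]] z by simp
    also have "\<dots> \<le> norm ?z * a n" using sin_x_le_x[of "a n"] a[of n] by (intro mult_left_mono) auto
    finally have "1 / a n \<le> norm ?z" using a[of n] by (simp add: field_simps)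
    from mult_right_mono[OF this that] show ?thesis unfolding z by simp
  qed
  \<comment> \<open>The strip has height at least 1, so a small argument of \<open>strip_map (V n)\<close> means a large real part.\<close>
  have "filterlim (\<lambda>n. inverse (a n) * cos (a n)) at_top sequentially"
  proof (rule filterlim_at_top_mult_tendsto_pos)
    show "(\<lambda>n. cos (a n)) \<longlonglongrightarrow> 1" using tendsto_cos[OF a0] by simp
    show "filterlim (\<lambda>n. inverse (a n)) at_top sequentially"
      by (rule filterlim_inverse_at_top[OF a0]) (simp add: a)
  qed simp
  hence "filterlim (\<lambda>n. cos (a n) / a n) at_top sequentially" by (simp add: field_simps)
  moreover have "eventually (\<lambda>n. cos (a n) > 0) sequentially"
    using tendsto_cos[OF a0] by (rule order_tendstoD) simp
  hence "eventually (\<lambda>n. cos (a n) / a n \<le> ln (norm (V n))) sequentially"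
  proof eventually_elim
    case (elim n)
    have "V n \<noteq> 0" using K[of n] by (simp add: closed_halfplane_def)
    hence "Re (strip_map (V n)) = ln (norm (V n))" by (simp add: strip_map_def)
    thus ?case using Re_st[of n] elim by simp
  qed
  ultimately have "filterlim (\<lambda>n. ln (norm (V n))) at_top sequentially" by (rule filterlim_at_top_mono)
  from filterlim_compose[OF exp_at_top this]
  have "filterlim (\<lambda>n. exp (ln (norm (V n)))) at_top sequentially" .
  moreover have "exp (ln (norm (V n))) = norm (V n)" for n
    using K[of n] by (simp add: closed_halfplane_def)
  ultimately have nV: "filterlim (\<lambda>n. norm (V n)) at_top sequentially" by simp
  have "((\<lambda>t::real. exp pi * t * (ln t + 5) / (t\<^sup>2 - 1)) \<longlongrightarrow> 0) at_top" by real_asymp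
  from filterlim_compose[OF this nV]
  have b0: "(\<lambda>n. exp pi * norm (V n) * (ln (norm (V n)) + 5) / ((norm (V n))\<^sup>2 - 1)) \<longlonglongrightarrow> 0" .
  show "(\<lambda>n. norm (gradient (zero_extension (spiral_domain s) (spiral_green s)) (y n))) \<longlonglongrightarrow> 0"
  proof (rule Lim_null_comparison[OF _ b0])
    have "eventually (\<lambda>n. norm (V n) \<ge> 2) sequentially" using nV by (simp add: filterlim_at_top)
    thus "eventually (\<lambda>n. norm (norm (gradient (zero_extension (spiral_domain s) (spiral_green s)) (y n)))
      \<le> exp pi * norm (V n) * (ln (norm (V n)) + 5) / ((norm (V n))\<^sup>2 - 1)) sequentially"
    proof eventually_elim
      case (elim n)
      show ?case using gradient_bound[OF s V(1) elim] unfolding V(2) by simp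
    qed
  qed
qed

lemma emeasure_ball_plane: "0 \<le> r \<Longrightarrow> emeasure lebesgue (ball (x::plane) r) = ennreal (pi * r\<^sup>2)"
  by (simp add: emeasure_ball unit_ball_vol_2)

lemma mean_energy_le:
  assumes r: "r > 0" and c: "c \<ge> 0" and u: "\<And>y. y \<in> ball x r \<Longrightarrow> norm (gradient u y) \<le> c"
  shows "mean_energy u x r \<le> ennreal (pi * c\<^sup>2)"
proof -
  have "(\<integral>\<^sup>+ y \<in> ball x r. ennreal ((norm (gradient u y))\<^sup>2) \<partial>lebesgue) \<le> (\<integral>\<^sup>+ y. ennreal (c\<^sup>2) * indicator (ball x r) y \<partial>lebesgue)"
    by (intro nn_integral_mono) (auto simp: indicator_def intro!: ennreal_leI power_mono u)
  also have "\<dots> = ennreal (c\<^sup>2) * emeasure lebesgue (ball x r)"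
    by (rule nn_integral_cmult_indicator) simp
  also have "\<dots> = ennreal (c\<^sup>2) * ennreal (pi * r\<^sup>2)"
    using r by (simp only: emeasure_ball_plane less_imp_le)
  also have "\<dots> = ennreal (pi * c\<^sup>2 * r\<^sup>2)" by (simp add: ennreal_mult'[symmetric] mult_ac)
  finally have "mean_energy u x r \<le> ennreal (pi * c\<^sup>2 * r\<^sup>2) / ennreal (r\<^sup>2)"
    unfolding mean_energy_def by (rule divide_right_mono_ennreal)
  also have "\<dots> = ennreal (pi * c\<^sup>2)" using r by (simp add: divide_ennreal)
  finally show ?thesis .
qed

text \<open>The gradient is uniformly small on the part of a small ball inside the domain and zero
  on the rest, and the normalisation r^2 matches the area pi r^2 of the ball.\<close>

lemma mean_energy_tendsto_0:
  assumes s: "\<bar>s\<bar> = 1" and x: "x \<in> to_plane ` sphere 0 1"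
  shows "((\<lambda>r. mean_energy (zero_extension (spiral_domain s) (spiral_green s)) x r) \<longlongrightarrow> 0) (at_right 0)"
proof (rule order_tendstoI)
  let ?u = "zero_extension (spiral_domain s) (spiral_green s)"
  fix a :: ennreal assume "0 < a"
  then obtain b where b: "0 < b" "b < a" using dense by blast
  then obtain e where e: "b = ennreal e" "e > 0" by (cases b) auto
  \<comment> \<open>Chosen so that a gradient bound \<open>c\<close> gives mean energy at most
    \<open>b\<close>.\<close>
  define c where "c = sqrt (e / pi)"
  have c: "c > 0" "pi * c\<^sup>2 = e" using e by (auto simp: c_def)
  have "eventually (\<lambda>y. norm (gradient ?u y) < c) (at x within spiral_domain s)"
    using gradient_tendsto_0[OF s x] c(1) by (rule order_tendstoD)
  then obtain d where d: "d > 0" "\<And>y. y \<in> spiral_domain s \<Longrightarrow> y \<noteq> x \<Longrightarrow> dist y x < d \<Longrightarrow> norm (gradient ?u y) < c"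
    unfolding eventually_at by blast
  have xn: "x \<notin> spiral_domain s"
    using x norm_spiral_image(1)[OF s] right_halfplane_closed by (auto simp: spiral_domain_def inj_eq[OF inj_to_plane])
  have "eventually (\<lambda>r. r \<in> {0<..<d}) (at_right 0)" by (rule eventually_at_rightI[OF _ d(1)]) simp
  thus "eventually (\<lambda>r. mean_energy ?u x r < a) (at_right 0)"
  proof eventually_elim
    case (elim r)
    have "norm (gradient ?u y) \<le> c" if "y \<in> ball x r" for y
    proof (cases "y \<in> spiral_domain s")
      case True
      thus ?thesis using d(2)[OF True] xn that elim by (force simp: dist_commute)
    qed (use gradient_outside[of y s] c in simp)
    hence "mean_energy ?u x r \<le> ennreal (pi * c\<^sup>2)"
      using elim c by (intro mean_energy_le) auto
    also have "\<dots> = b" using c e by simp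
    finally show ?case using b by simp
  qed
qed simp

subsection \<open>Hausdorff measure and rectifiability\<close>

lemma hausdorff1_empty: "hausdorff1 {} = 0"
proof -
  have "hausdorff1_content \<delta> {} = 0" if "\<delta> > 0" for \<delta>
  proof -
    have "hausdorff1_content \<delta> {} \<le> (\<Sum>i::nat. ennreal (diameter ({}::plane set)))"
      unfolding hausdorff1_content_def by (rule INF_lower2[of "\<lambda>_. {}"]) (use that in auto)
    thus ?thesis by simp
  qed
  thus ?thesis unfolding hausdorff1_def by simp
qed

text \<open>Project to the first coordinate: the circle covers [-1, 1], and a covering set of
  diameter d projects into an interval of length 2 d. Lebesgue measure then bounds the sum of the
  diameters from below by 1.\<close>

lemma hausdorff1_unit_circle_pos: "hausdorff1 (to_plane ` sphere 0 1) > 0"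
proof -
  let ?E = "to_plane ` sphere 0 1"
  have "1 \<le> hausdorff1_content 1 ?E"
    unfolding hausdorff1_content_def
  proof (rule INF_greatest, clarsimp)
    fix C :: "nat \<Rightarrow> plane set"
    assume cov: "?E \<subseteq> (\<Union>i. C i)" and C: "\<forall>i. bounded (C i) \<and> diameter (C i) \<le> 1"
    \<comment> \<open>Any point of \<open>C i\<close> can serve as the centre of its interval. For
      empty \<open>C i\<close> the diameter is 0, and the interval is a single point.\<close>
    define c where "c i = Re (of_plane (SOME x. x \<in> C i))" for i
    define d where "d i = diameter (C i)" for i
    have d0: "d i \<ge> 0" for i using C diameter_ge_0[of "C i"] by (simp add: d_def)
    have sub: "{-1..1} \<subseteq> (\<Union>i. {c i - d i..c i + d i})"
    proof
      fix t :: real assume t: "t \<in> {-1..1}"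
      hence "t\<^sup>2 \<le> 1" by (simp add: abs_square_le_1 abs_le_iff)
      hence "Complex t (sqrt (1 - t\<^sup>2)) \<in> sphere 0 1" by (simp add: cmod_def)
      then obtain i where i: "to_plane (Complex t (sqrt (1 - t\<^sup>2))) \<in> C i" using cov by blast
      hence "(SOME x. x \<in> C i) \<in> C i" by (rule someI)
      with i have "dist (to_plane (Complex t (sqrt (1 - t\<^sup>2)))) (SOME x. x \<in> C i) \<le> d i"
        unfolding d_def using C by (intro diameter_bounded_bound) auto
      hence "norm (Complex t (sqrt (1 - t\<^sup>2)) - of_plane (SOME x. x \<in> C i)) \<le> d i"
        by (metis dist_norm dist_to_plane to_plane_of_plane)
      from order_trans[OF abs_Re_le_cmod this] have "\<bar>t - c i\<bar> \<le> d i" by (simp add: c_def)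
      thus "t \<in> (\<Union>i. {c i - d i..c i + d i})" by (auto simp: abs_le_iff intro!: exI[of _ i])
    qed
    have "ennreal 2 = emeasure lborel {-1..1::real}" by simp
    also have "\<dots> \<le> emeasure lborel (\<Union>i. {c i - d i..c i + d i})"
      by (rule emeasure_mono[OF sub]) simp
    also have "\<dots> \<le> (\<Sum>i. emeasure lborel {c i - d i..c i + d i})"
      by (rule emeasure_subadditive_countably) auto
    also have "\<dots> = (\<Sum>i. 2 * ennreal (d i))"
      using d0 by (simp add: ennreal_mult')
    also have "\<dots> = 2 * (\<Sum>i. ennreal (d i))" by (rule ennreal_suminf_cmult)
    finally have "2 * 1 \<le> 2 * (\<Sum>i. ennreal (d i))" by simp
    thus "1 \<le> (\<Sum>i. ennreal (diameter (C i)))"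
      by (subst (asm) ennreal_mult_le_mult_iff) (auto simp: d_def)
  qed
  also have "\<dots> \<le> hausdorff1 ?E" unfolding hausdorff1_def by (rule SUP_upper) simp
  finally show ?thesis by (rule less_le_trans[rotated]) simp
qed

text \<open>Although the arc winds infinitely often, its speed is bounded when it is parametrised by
  the horizontal line in the strip: at height at least 1 the derivative 1/z of the logarithm has
  modulus at most 1, and the exponential has modulus at most \<open>exp pi\<close>.\<close>

lemma lipschitz_spiral_arc:
  assumes s: "\<bar>s\<bar> = 1" and c: "c \<ge> 1"
  shows "(exp pi)-lipschitz_on UNIV (\<lambda>t. to_plane (exp (of_real s * \<i> * Ln (of_real t + of_real c * \<i>))))"
proof (rule lipschitz_onI)
  fix t t' :: real
  let ?g = "\<lambda>z. exp (of_real s * \<i> * Ln z)"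
  have "norm (?g (of_real t + of_real c * \<i>) - ?g (of_real t' + of_real c * \<i>))
     \<le> exp pi * norm ((of_real t + of_real c * \<i>) - (of_real t' + of_real c * \<i>))"
  proof (rule field_differentiable_bound[where S="{z. Im z \<ge> 1}" and f'="\<lambda>z. ?g z * (of_real s * \<i> * inverse z)"])
    fix z :: complex assume "z \<in> {z. Im z \<ge> 1}"
    hence z: "Im z \<ge> 1" by simp
    hence nn: "z \<notin> \<real>\<^sub>\<le>\<^sub>0" by (auto simp: complex_nonpos_Reals_iff)
    show "(?g has_field_derivative ?g z * (of_real s * \<i> * inverse z)) (at z within {z. Im z \<ge> 1})"
      by (rule has_field_derivative_at_within, rule DERIV_chain2[OF DERIV_exp DERIV_cmult[OF has_field_derivative_Ln[OF nn]]])
    have "norm z \<ge> 1" using z abs_Im_le_cmod[of z] by linarith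
    hence "norm (of_real s * \<i> * inverse z) \<le> 1" using s by (simp add: norm_mult norm_inverse inverse_le_1_iff)
    moreover have "norm (?g z) \<le> exp pi"
      using Im_Ln_pos_lt_imp[of z] z s by (auto simp: abs_if split: if_splits)
    ultimately show "norm (?g z * (of_real s * \<i> * inverse z)) \<le> exp pi"
      unfolding norm_mult[of "?g z"] using mult_mono[of "norm (?g z)" "exp pi" "norm (of_real s * \<i> * inverse z)" 1] by simp
  qed (use c in \<open>auto simp: convex_halfspace_Im_ge\<close>)
  also have "\<dots> = exp pi * dist t t'"
  proof -
    have "(of_real t + of_real c * \<i>) - (of_real t' + of_real c * \<i>) = complex_of_real (t - t')" by simp
    thus ?thesis by (simp only: norm_of_real dist_real_def)
  qed
  finally show "dist (to_plane (?g (of_real t + of_real c * \<i>))) (to_plane (?g (of_real t' + of_real c * \<i>))) \<le> exp pi * dist t t'"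
    by (simp add: dist_norm[of "exp _"])
qed simp

lemma lipschitz_circle:
  assumes "R \<ge> 0" shows "R-lipschitz_on UNIV (\<lambda>t. to_plane (of_real R * exp (\<i> * of_real t)))"
proof (rule lipschitz_onI)
  fix t t' :: real
  have "norm (exp (\<i> * of_real t) - exp (\<i> * of_real t')) \<le> 1 * norm (complex_of_real t - of_real t')"
  \<comment> \<open>On this convex set containing the real line, exp (\<i> z) has modulus exp (- Im
    z) \<le> 1.\<close>
  proof (rule field_differentiable_bound[where S="{z. Im z \<ge> 0}" and f'="\<lambda>z. exp (\<i> * z) * \<i>"])
    show "((\<lambda>z. exp (\<i> * z)) has_field_derivative exp (\<i> * z) * \<i>) (at z within {z. Im z \<ge> 0})" for z
      by (auto intro!: derivative_eq_intros)
  qed (auto simp: convex_halfspace_Im_ge norm_mult)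
  also have "\<dots> = dist t t'" unfolding of_real_diff[symmetric] norm_of_real by (simp add: dist_real_def)
  finally have "norm (exp (\<i> * of_real t) - exp (\<i> * of_real t')) \<le> dist t t'" .
  hence "R * norm (exp (\<i> * of_real t) - exp (\<i> * of_real t')) \<le> R * dist t t'" using assms by (rule mult_left_mono)
  thus "dist (to_plane (of_real R * exp (\<i> * of_real t))) (to_plane (of_real R * exp (\<i> * of_real t'))) \<le> R * dist t t'"
    unfolding dist_to_plane unfolding dist_norm right_diff_distrib[symmetric] norm_mult using assms by (simp add: dist_norm)
qed (fact assms)

lemma sphere_subset_circle: "sphere 0 R \<subseteq> range (\<lambda>t. of_real R * exp (\<i> * of_real t))"
proof
  fix z :: complex assume z: "z \<in> sphere 0 R"
  have "z = of_real R * exp (\<i> * of_real (Arg z))"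
  proof (cases "z = 0")
    case False thus ?thesis using Arg_eq[of z] z by simp
  qed (use z in auto)
  thus "z \<in> range (\<lambda>t. of_real R * exp (\<i> * of_real t))" by blast
qed

text \<open>The two rays of the imaginary axis have logarithms of imaginary part pi/2 and - pi/2, so
  they become the edges of the strip, at heights 3 + pi/2 and 3 - pi/2.\<close>

lemma spiral_boundary_arc:
  assumes "V \<in> closed_halfplane - right_halfplane"
  obtains t where "spiral s V = exp (of_real s * \<i> * Ln (of_real t + of_real (3 + pi/2) * \<i>))"
  | t where "spiral s V = exp (of_real s * \<i> * Ln (of_real t + of_real (3 - pi/2) * \<i>))"
proof -
  have V: "Re V = 0" "Im V \<noteq> 0"
    using assms by (auto simp: closed_halfplane_def right_halfplane_def complex_eq_iff)
  hence V0: "V \<noteq> 0" by auto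
  have K: "V \<in> closed_halfplane" using assms by simp
  have "Re (exp (Ln V)) = 0" using V V0 by simp
  hence "cos (Im (Ln V)) = 0" unfolding Re_exp by simp
  with Im_Ln_closed_halfplane[OF K] have "\<bar>Im (Ln V)\<bar> = pi / 2"
    using cos_gt_zero_pi[of "Im (Ln V)"] by (smt (verit))
  hence "Im (Ln V) = pi / 2 \<or> Im (Ln V) = - (pi / 2)" by linarith
  thus ?thesis
  proof
    assume "Im (Ln V) = pi / 2"
    hence "strip_map V = of_real (Re (Ln V)) + of_real (3 + pi/2) * \<i>"
      by (simp add: strip_map_def complex_eq_iff)
    thus ?thesis using that(1)[of "Re (Ln V)"] unfolding spiral_def by simp
  next
    assume "Im (Ln V) = - (pi / 2)"
    hence "strip_map V = of_real (Re (Ln V)) + of_real (3 - pi/2) * \<i>"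
      by (simp add: strip_map_def complex_eq_iff)
    thus ?thesis using that(2)[of "Re (Ln V)"] unfolding spiral_def by simp
  qed
qed

theorem rectifiable_spiral_frontier:
  assumes s: "\<bar>s\<bar> = 1" shows "rectifiable1 (frontier (spiral_domain s))"
proof -
  define arc where "arc c t = to_plane (exp (of_real s * \<i> * Ln (of_real t + of_real c * \<i>)))" for c t
  define circ where "circ R t = to_plane (of_real R * exp (\<i> * of_real t))" for R t
  \<comment> \<open>Two limit circles and two edge spirals already cover the whole frontier; indices
    from 3 on repeat the last arc.\<close>
  define f where "f i = (if i = 0 then circ 1 else if i = 1 then circ (exp (- s * pi))
     else if i = 2 then arc (3 + pi/2) else arc (3 - pi/2))" for i :: nat
  have "\<exists>L. L-lipschitz_on UNIV (f i)" for i
    using lipschitz_circle[of 1] lipschitz_circle[of "exp (- s * pi)"]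
      lipschitz_spiral_arc[OF s, of "3 + pi/2"] lipschitz_spiral_arc[OF s, of "3 - pi/2"] pi_less_4 pi_gt_zero
    unfolding f_def arc_def[abs_def] circ_def[abs_def] by (auto simp del: of_real_add of_real_diff)
  moreover have "frontier (spiral_domain s) \<subseteq> (\<Union>i. range (f i))"
  proof
    fix x assume "x \<in> frontier (spiral_domain s)"
    then obtain z where x: "x = to_plane z" and z: "z \<in> frontier (spiral s ` right_halfplane)"
      unfolding frontier_spiral_domain[OF s] by blast
    consider "z \<in> spiral s ` (closed_halfplane - right_halfplane)" | "z \<in> sphere 0 1" | "z \<in> sphere 0 (exp (- s * pi))"
      using frontier_spiral_subset[OF s] z by blast
    then consider t where "x = circ 1 t" | t where "x = circ (exp (- s * pi)) t"
      | t where "x = arc (3 + pi/2) t" | t where "x = arc (3 - pi/2) t"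
    proof cases
      case 1
      then obtain V where V: "V \<in> closed_halfplane - right_halfplane" "z = spiral s V" by blast
      show ?thesis
        by (rule spiral_boundary_arc[OF V(1), of s]) (use that(3,4) x V(2) in \<open>auto simp only: arc_def\<close>)
    next
      case 2
      then obtain t where "z = of_real 1 * exp (\<i> * of_real t)" using sphere_subset_circle by blast
      thus ?thesis using that(1) x unfolding circ_def by blast
    next
      case 3
      then obtain t where "z = of_real (exp (- s * pi)) * exp (\<i> * of_real t)" using sphere_subset_circle by blast
      thus ?thesis using that(2) x unfolding circ_def by blast
    qed
    hence "x \<in> range (f 0) \<or> x \<in> range (f 1) \<or> x \<in> range (f 2) \<or> x \<in> range (f 3)"
      unfolding f_def by cases auto
    thus "x \<in> (\<Union>i. range (f i))" by blast
  qed
  hence "frontier (spiral_domain s) - (\<Union>i. range (f i)) = {}" by (simp only: Diff_eq_empty_iff)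
  ultimately show ?thesis unfolding rectifiable1_def
    by (intro exI[of _ f] conjI) (simp_all only: hausdorff1_empty, blast)
qed

section \<open>The two domains together\<close>

lemma spiral_domains_disjoint: "spiral_domain 1 \<inter> spiral_domain (-1) = {}"
proof -
  have "norm (spiral 1 V) < 1" "norm (spiral (-1) V) > 1" if "V \<in> right_halfplane" for V
    using norm_spiral_image[of 1 V] norm_spiral_image[of "-1" V] right_halfplane_closed[OF that] by auto
  moreover have "norm x < 1" if "x \<in> spiral_domain 1" for x
    using that calculation(1) by (auto simp: spiral_domain_def)
  moreover have "norm x > 1" if "x \<in> spiral_domain (-1)" for x
    using that calculation(2) by (auto simp: spiral_domain_def)
  ultimately show ?thesis by force
qed

text \<open>One closure lies in the closed unit disc and the other in the closed exterior, so only
  the unit circle can be shared; the remaining limit circles and the bounding spirals are separated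
  by their moduli.\<close>

lemma spiral_frontiers_inter:
  "frontier (spiral_domain 1) \<inter> frontier (spiral_domain (-1)) = to_plane ` sphere 0 1"
proof
  have 1: "norm (spiral 1 V) < 1" and 2: "norm (spiral (-1) V) > 1" if "V \<in> right_halfplane" for V
    using norm_spiral_image[of 1 V] norm_spiral_image[of "-1" V] right_halfplane_closed[OF that] by auto
  have "closure (spiral_domain 1) \<subseteq> {x. norm x \<le> 1}"
  proof (rule closure_minimal)
    show "spiral_domain 1 \<subseteq> {x. norm x \<le> 1}" using 1 less_imp_le by (fastforce simp: spiral_domain_def)
  qed (intro closed_Collect_le continuous_intros)
  moreover have "closure (spiral_domain (-1)) \<subseteq> {x. norm x \<ge> 1}"
  proof (rule closure_minimal)
    show "spiral_domain (-1) \<subseteq> {x. norm x \<ge> 1}" using 2 less_imp_le by (fastforce simp: spiral_domain_def)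
  qed (intro closed_Collect_le continuous_intros)
  ultimately have "norm x = 1" if "x \<in> frontier (spiral_domain 1) \<inter> frontier (spiral_domain (-1))" for x
    using that by (auto simp: frontier_def intro!: antisym)
  thus "frontier (spiral_domain 1) \<inter> frontier (spiral_domain (-1)) \<subseteq> to_plane ` sphere 0 1"
    by (auto simp: to_plane_image_iff')
  show "to_plane ` sphere 0 1 \<subseteq> frontier (spiral_domain 1) \<inter> frontier (spiral_domain (-1))"
    using unit_circle_subset_frontier[of 1] unit_circle_subset_frontier[of "-1"]
    by (auto simp: frontier_spiral_domain)
qed

text \<open>The measure lives on the images of the edges of the strip, where the argument is
  strictly between 0 and pi and the modulus therefore differs from 1.\<close>

lemma spiral_measure_unit_circle:
  assumes s: "\<bar>s\<bar> = 1" shows "emeasure (spiral_measure s) (to_plane ` sphere 0 1) = 0"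
proof (rule emeasure_spiral_measure_0)
  have "to_plane ` sphere 0 1 = sphere 0 1" by (auto simp: to_plane_image_iff')
  thus "to_plane ` sphere 0 1 \<in> sets borel" by simp
  show "boundary_map s t \<notin> to_plane ` sphere 0 1" if "t \<in> circle_times" for t
    using norm_spiral_image(1)[OF s cayley_boundary(1)[OF norm_circle_point circle_point_ne[OF that]]]
    by (simp add: boundary_map_eq[OF that])
qed

theorem mainTheorem6:
  shows "\<exists>(\<Omega>\<^sub>1 :: plane set) (\<Omega>\<^sub>2 :: plane set) p\<^sub>1 p\<^sub>2 \<omega>\<^sub>1 \<omega>\<^sub>2 g\<^sub>1 g\<^sub>2.
    domain \<Omega>\<^sub>1 \<and> domain \<Omega>\<^sub>2 \<and> \<Omega>\<^sub>1 \<inter> \<Omega>\<^sub>2 = {} \<and>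
    wiener_regular \<Omega>\<^sub>1 \<and> wiener_regular \<Omega>\<^sub>2 \<and>
    rectifiable1 (frontier \<Omega>\<^sub>1) \<and> rectifiable1 (frontier \<Omega>\<^sub>2) \<and>
    p\<^sub>1 \<in> \<Omega>\<^sub>1 \<and> p\<^sub>2 \<in> \<Omega>\<^sub>2 \<and>
    harmonic_measure \<Omega>\<^sub>1 p\<^sub>1 \<omega>\<^sub>1 \<and> harmonic_measure \<Omega>\<^sub>2 p\<^sub>2 \<omega>\<^sub>2 \<and>
    green_function \<Omega>\<^sub>1 p\<^sub>1 g\<^sub>1 \<and> green_function \<Omega>\<^sub>2 p\<^sub>2 g\<^sub>2 \<and>
    (let E = frontier \<Omega>\<^sub>1 \<inter> frontier \<Omega>\<^sub>2;
         J = acf_functional (zero_extension \<Omega>\<^sub>1 g\<^sub>1) (zero_extension \<Omega>\<^sub>2 g\<^sub>2)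
     in hausdorff1 E > 0 \<and>
        emeasure \<omega>\<^sub>1 E = 0 \<and> emeasure \<omega>\<^sub>2 E = 0 \<and>
        hausdorff1 {x \<in> E. \<not> ((J x \<longlongrightarrow> 0) (at_right 0))} = 0)"
proof -
  let ?\<Omega>\<^sub>1 = "spiral_domain 1" and ?\<Omega>\<^sub>2 = "spiral_domain (-1)"
  let ?J = "acf_functional (zero_extension ?\<Omega>\<^sub>1 (spiral_green 1)) (zero_extension ?\<Omega>\<^sub>2 (spiral_green (-1)))"
  \<comment> \<open>Both factors tend to 0 at every point of the circle, so the exceptional set is
    empty and not merely null.\<close>
  have "(?J x \<longlongrightarrow> 0) (at_right 0)" if "x \<in> to_plane ` sphere 0 1" for x
  proof -
    have "(?J x \<longlongrightarrow> 0 * 0) (at_right 0)"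
      unfolding acf_functional_def[abs_def]
      by (intro tendsto_mult_ennreal mean_energy_tendsto_0 that) auto
    thus ?thesis by simp
  qed
  hence "{x \<in> to_plane ` sphere 0 1. \<not> ((?J x \<longlongrightarrow> 0) (at_right 0))} = {}" by blast
  thus ?thesis
    unfolding Let_def
    by (intro exI[of _ ?\<Omega>\<^sub>1] exI[of _ ?\<Omega>\<^sub>2] exI[of _ "spiral_pole 1"] exI[of _ "spiral_pole (-1)"]
          exI[of _ "spiral_measure 1"] exI[of _ "spiral_measure (-1)"]
          exI[of _ "spiral_green 1"] exI[of _ "spiral_green (-1)"] conjI)
      (simp_all only: spiral_frontiers_inter, simp_all add: domain_spiral_domain spiral_domains_disjoint
        wiener_regular_spiral_domain rectifiable_spiral_frontier spiral_pole_in harmonic_measure_spiral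
        green_function_spiral hausdorff1_unit_circle_pos spiral_measure_unit_circle hausdorff1_empty)
qed

end
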